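(* Let $M$ be a smooth compact connected manifold (with or without boundary), and let $f$ be a $P$-function on $M$ which, in the case of a manifold with boundary, takes a constant maximal value on the boundary and has no critical points on the boundary. Then the number of critical submanifolds of $f$ is at least $P\text{-}\mathrm{cat}\,M$.
   Context: **$P$-function.** Let $P$ be a fixed smooth manifold without boundary. A differentiable function on a manifold whose set of critical points is a disjoint union of smooth submanifolds without boundary is called a $P$-function if each of its critical submanifolds is homeomorphic to $P$. **$P$-category.** Let $X$ be a Hausdorff space and $P\subset X$ a closed subset. $P\text{-}\mathrm{cat}\,X$ is the minimal number $k$ of closed subsets $A_1,\dots,A_k$ of $X$ such that $X=\bigcup_{i=1}^k A_i$ and each $A_i$ is contractible within $X$ to $P$, i.e. for each $i$ there is a homotopy $F_i\colon A_i\times[0,1]\to X$ with $F_i(x,0)=x$ for $x\in A_i$, and $F_i(A_i\times\{1\})=P_i\subset X$ where $P_i$ is homeomorphic to $P$. If no such $k$ exists, $P\text{-}\mathrm{cat}\,X=\infty$. (Only the homeomorphism type of $P$ matters.) *)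

theory Defs
  imports "HOL-Analysis.Analysis" "HOL-Library.Extended_Nat"
begin

section \<open>Differentiability classes on subsets of Euclidean space\<close>

text \<open>Meaningful for open \<open>U\<close> and \<open>'a\<close> finite-dimensional, where continuity of all directional
  derivatives amounts to continuity of the derivative.\<close>

primrec C_k_open ::
  "nat \<Rightarrow> 'a::euclidean_space set \<Rightarrow> ('a \<Rightarrow> 'b::real_normed_vector) \<Rightarrow> bool" where
  "C_k_open 0 U f \<longleftrightarrow> continuous_on U f"
| "C_k_open (Suc k) U f \<longleftrightarrow>
     (\<forall>x\<in>U. f differentiable (at x)) \<and>
     (\<forall>v. C_k_open k U (\<lambda>x. frechet_derivative f (at x) v))"

text \<open>On an arbitrary set, such as an open piece of a half-space or of a coordinate subspace,
  a map is of class \<open>C\<^sup>k\<close> if it extends locally to a \<open>C\<^sup>k\<close> map on an open subset of the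
  ambient space; \<open>k = \<infinity>\<close> means smooth.\<close>

definition C_k_on ::
  "enat \<Rightarrow> 'a::euclidean_space set \<Rightarrow> ('a \<Rightarrow> 'b::real_normed_vector) \<Rightarrow> bool" where
  "C_k_on k S f \<longleftrightarrow>
     (\<forall>x\<in>S. \<exists>U g. open U \<and> x \<in> U \<and> (\<forall>j. enat j \<le> k \<longrightarrow> C_k_open j U g) \<and>
                  (\<forall>y\<in>S \<inter> U. g y = f y))"

section \<open>Smooth manifolds, possibly with boundary\<close>

text \<open>A chart is a pair of its domain and its coordinate map.  The model space of dimension
  \<open>n\<close> is the coordinate subspace \<open>span B\<close> of a Euclidean type, where \<open>B \<subseteq> Basis\<close> has \<open>n\<close>
  elements.  With \<open>B = Basis\<close> this is the whole space; proper subsets are admitted because a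
  Euclidean type has positive dimension, whereas manifolds of dimension \<open>0\<close> are needed.\<close>

type_synonym ('a, 'e) chart = "'a set \<times> ('a \<Rightarrow> 'e)"

definition half_space :: "'e::euclidean_space set \<Rightarrow> 'e \<Rightarrow> 'e set" where
  "half_space B b = {x \<in> span B. 0 \<le> x \<bullet> b}"

definition is_chart ::
  "'e::euclidean_space set \<Rightarrow> 'a topology \<Rightarrow> ('a, 'e) chart \<Rightarrow> bool" where
  "is_chart B X = (\<lambda>(U, \<phi>).
     openin X U \<and>
     homeomorphic_map (subtopology X U) (top_of_set (\<phi> ` U)) \<phi> \<and>
     (openin (top_of_set (span B)) (\<phi> ` U) \<or>
      (\<exists>b\<in>B. openin (top_of_set (half_space B b)) (\<phi> ` U))))"

definition compatible_charts ::
  "('a, 'e::euclidean_space) chart \<Rightarrow> ('a, 'e) chart \<Rightarrow> bool" where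
  "compatible_charts = (\<lambda>(U, \<phi>) (V, \<psi>).
     C_k_on \<infinity> (\<phi> ` (U \<inter> V)) (\<psi> \<circ> inv_into U \<phi>) \<and>
     C_k_on \<infinity> (\<psi> ` (U \<inter> V)) (\<phi> \<circ> inv_into V \<psi>))"

definition smooth_manifold ::
  "'e::euclidean_space set \<Rightarrow> ('a, 'e) chart set \<Rightarrow> 'a topology \<Rightarrow> bool" where
  "smooth_manifold B \<A> X \<longleftrightarrow>
     B \<subseteq> Basis \<and> Hausdorff_space X \<and> second_countable X \<and>
     (\<forall>c\<in>\<A>. is_chart B X c) \<and>
     (\<Union>(U, \<phi>)\<in>\<A>. U) = topspace X \<and>
     (\<forall>c\<in>\<A>. \<forall>d\<in>\<A>. compatible_charts c d)"

definition manifold_boundary ::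
  "'e::euclidean_space set \<Rightarrow> ('a, 'e) chart set \<Rightarrow> 'a set" where
  "manifold_boundary B \<A> =
     {p. \<exists>(U, \<phi>)\<in>\<A>. p \<in> U \<and>
           (\<exists>b\<in>B. openin (top_of_set (half_space B b)) (\<phi> ` U) \<and> \<phi> p \<bullet> b = 0)}"

text \<open>Embedded submanifolds without boundary, by slice charts taken from the maximal atlas.
  The chart images are required to be open in the full model space, so the submanifold lies
  in the interior of the ambient manifold.\<close>

definition submanifold_without_boundary ::
  "'e::euclidean_space set \<Rightarrow> ('a, 'e) chart set \<Rightarrow> 'a topology \<Rightarrow> 'a set \<Rightarrow> bool" where
  "submanifold_without_boundary B \<A> X N \<longleftrightarrow>
     N \<subseteq> topspace X \<and>
     (\<exists>d. \<forall>p\<in>N. \<exists>U \<phi> C. p \<in> U \<and>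
        is_chart B X (U, \<phi>) \<and> (\<forall>c\<in>\<A>. compatible_charts (U, \<phi>) c) \<and>
        openin (top_of_set (span B)) (\<phi> ` U) \<and>
        C \<subseteq> B \<and> card C = d \<and> \<phi> ` (U \<inter> N) = \<phi> ` U \<inter> span C)"

section \<open>Critical submanifolds and \<open>P\<close>-functions\<close>

text \<open>``Differentiable function'' is read as ``of class \<open>C\<^sup>1\<close>'', which includes the
  smooth case.  Mere differentiability at every point does not suffice:
  \<open>y (y\<^sup>2 - x\<^sup>4) / (y\<^sup>2 + x\<^sup>4)\<close>, extended by \<open>0\<close> at the origin, is differentiable without
  critical points, yet its zero set consists of three curves through the origin.\<close>

definition C1_function ::
  "('a, 'e::euclidean_space) chart set \<Rightarrow> ('a \<Rightarrow> real) \<Rightarrow> bool" where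
  "C1_function \<A> f \<longleftrightarrow> (\<forall>(U, \<phi>)\<in>\<A>. C_k_on 1 (\<phi> ` U) (f \<circ> inv_into U \<phi>))"

definition critical_points ::
  "('a, 'e::euclidean_space) chart set \<Rightarrow> ('a \<Rightarrow> real) \<Rightarrow> 'a set" where
  "critical_points \<A> f =
     {p. \<exists>(U, \<phi>)\<in>\<A>. p \<in> U \<and>
           ((f \<circ> inv_into U \<phi>) has_derivative (\<lambda>_. 0)) (at (\<phi> p) within \<phi> ` U)}"

text \<open>The critical submanifolds are the connected components of the set of critical points,
  which is always their disjoint union.  Connectedness matters: if \<open>P\<close> were a two-point space,
  the height function on a circle would have a single critical submanifold, while the circle,
  being connected, cannot be deformed onto two points.\<close>

definition critical_submanifolds ::
  "('a, 'e::euclidean_space) chart set \<Rightarrow> 'a topology \<Rightarrow> ('a \<Rightarrow> real) \<Rightarrow> 'a set set" where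
  "critical_submanifolds \<A> X f = connected_components_of (subtopology X (critical_points \<A> f))"

definition P_function ::
  "'p topology \<Rightarrow> 'e::euclidean_space set \<Rightarrow> ('a, 'e) chart set \<Rightarrow> 'a topology \<Rightarrow>
   ('a \<Rightarrow> real) \<Rightarrow> bool" where
  "P_function P B \<A> X f \<longleftrightarrow>
     C1_function \<A> f \<and>
     (\<forall>N\<in>critical_submanifolds \<A> X f.
        submanifold_without_boundary B \<A> X N \<and> subtopology X N homeomorphic_space P)"

definition ecard :: "'a set \<Rightarrow> enat" where
  "ecard S = (if finite S then enat (card S) else \<infinity>)"

section \<open>\<open>P\<close>-category\<close>

definition contractible_within_to :: "'p topology \<Rightarrow> 'a topology \<Rightarrow> 'a set \<Rightarrow> bool" where
  "contractible_within_to P X A \<longleftrightarrow>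
     (\<exists>g. homotopic_with (\<lambda>_. True) (subtopology X A) X id g \<and>
          subtopology X (g ` A) homeomorphic_space P)"

text \<open>The infimum of the empty set of extended naturals is \<open>\<infinity>\<close>.\<close>

definition P_cat :: "'p topology \<Rightarrow> 'a topology \<Rightarrow> enat" where
  "P_cat P X = Inf (enat ` {k. \<exists>A :: nat \<Rightarrow> 'a set.
     (\<forall>i<k. closedin X (A i) \<and> contractible_within_to P X (A i)) \<and>
     topspace X = (\<Union>i<k. A i)})"

end

theory Submission
  imports Defs
begin

text \<open>
  The classical argument deforms \<open>M\<close> along the negative gradient flow of \<open>f\<close>.  A \<open>C\<^sup>1\<close> function
  has only a continuous gradient, which need not generate a flow, so flows are replaced here by
  finite compositions of pushes that each live in a single chart.  Call a self-map of \<open>M\<close>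
  homotopic to the identity and fixing a set \<open>K\<close> pointwise a deformation map for \<open>K\<close>;
  such maps are closed under composition.

  Two kinds of pushes are used.  Near a regular point there is, in a chart, a direction along
  which \<open>f\<close> decreases; moving points a little in that direction, with a cut-off, gives a
  deformation map that fixes all critical points and lowers \<open>f\<close> wherever it moves anything.  At a
  boundary point the direction can be chosen to point inwards because \<open>f\<close> is maximal there.
  Composing finitely many such maps lowers \<open>f\<close> on any prescribed compact set of regular points
  (\<open>descending_map_at_regular_point\<close>, \<open>descending_map_on_compact\<close>).
  Near a point of a critical submanifold \<open>N\<close>, a slice chart allows points to be pushed
  linearly onto \<open>N\<close> while \<open>N\<close> stays fixed.  Composing finitely many of these pushes carries a
  whole neighbourhood of \<open>N\<close> into \<open>N\<close>
  (\<open>neighbourhood_deforms_onto_submanifold\<close>).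

  The function is constant on each \<open>N\<close>, so one can climb through the sublevel sets.  The
  invariant for level \<open>a\<close> is that every critical submanifold \<open>N\<close> with value below \<open>a\<close> has its own
  deformation map \<open>g\<^sub>N\<close>, fixing \<open>N\<close>, such that \<open>{f \<le> a}\<close> is covered by the sets
  \<open>g\<^sub>N\<^sup>-\<^sup>1(N)\<close>.  Crossing a level \<open>c\<close> works as follows: points of the slightly
  larger sublevel set either lie near a critical submanifold at level \<open>c\<close>, which brings its own
  deformation map, or are lowered below \<open>c\<close> by a descending map \<open>h\<close>, after which the old maps
  apply, so that \<open>g\<^sub>N\<close> becomes \<open>g\<^sub>N \<circ> h\<close> (\<open>sublevel_cover_cross\<close>,
  \<open>critical_sets_cover\<close>).  At the top, the closed sets \<open>g\<^sub>N\<^sup>-\<^sup>1(N)\<close> cover \<open>M\<close>,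
  one for each critical submanifold, and \<open>g\<^sub>N\<close> maps each of them exactly onto \<open>N\<close> because it
  fixes \<open>N\<close> (\<open>P_cat_le_card\<close>).
\<close>

section \<open>Deformation maps and descending maps\<close>

text \<open>Only the end map is required to fix \<open>K\<close>; the homotopy itself may move it, since
  \<open>P\<close>-category asks for nothing more.\<close>

definition deformation_map :: "'a topology \<Rightarrow> 'a set \<Rightarrow> ('a \<Rightarrow> 'a) \<Rightarrow> bool" where
  "deformation_map X K h \<longleftrightarrow>
     homotopic_with (\<lambda>_. True) X X id h \<and> (\<forall>x\<in>K. h x = x)"

lemma deformation_map_id: "deformation_map X K id"
  by (simp add: deformation_map_def)

lemma deformation_map_continuous: "deformation_map X K h \<Longrightarrow> continuous_map X X h"
  using homotopic_with_imp_continuous_maps unfolding deformation_map_def by blast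

lemma deformation_map_into: "deformation_map X K h \<Longrightarrow> x \<in> topspace X \<Longrightarrow> h x \<in> topspace X"
  using deformation_map_continuous continuous_map_image_subset_topspace by fastforce

lemma deformation_map_mono: "deformation_map X K h \<Longrightarrow> L \<subseteq> K \<Longrightarrow> deformation_map X L h"
  unfolding deformation_map_def by blast

lemma deformation_map_compose:
  assumes g: "deformation_map X K g" and h: "deformation_map X K h"
  shows "deformation_map X K (g \<circ> h)"
proof -
  have "homotopic_with (\<lambda>_. True) X X (id \<circ> h) (g \<circ> h)"
    using g deformation_map_continuous[OF h] unfolding deformation_map_def
    by (intro homotopic_with_compose_continuous_map_right[where p = "\<lambda>_. True"]) auto
  then have "homotopic_with (\<lambda>_. True) X X id (g \<circ> h)"
    using h homotopic_with_trans unfolding deformation_map_def by (metis id_comp)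
  then show ?thesis
    using g h unfolding deformation_map_def by simp
qed

text \<open>The alternative ``stay put or strictly decrease'' is what survives composition with full
  information: if a composite fails to lower \<open>f\<close> at a point, then none of its factors has moved
  the point, so every factor was applied to that very point.  Merely not increasing \<open>f\<close> would
  not allow this conclusion.\<close>

definition descending_map :: "'a topology \<Rightarrow> 'a set \<Rightarrow> ('a \<Rightarrow> real) \<Rightarrow> ('a \<Rightarrow> 'a) \<Rightarrow> bool" where
  "descending_map X K f h \<longleftrightarrow>
     deformation_map X K h \<and> (\<forall>x\<in>topspace X. h x = x \<or> f (h x) < f x)"

lemma descending_map_imp_deformation_map: "descending_map X K f h \<Longrightarrow> deformation_map X K h"
  unfolding descending_map_def by simp

lemma descending_map_le: "descending_map X K f h \<Longrightarrow> x \<in> topspace X \<Longrightarrow> f (h x) \<le> f x"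
  unfolding descending_map_def by (metis less_eq_real_def)

text \<open>The composite of all the maps lowers \<open>f\<close> wherever at least one of them does: the first
  factors either lower \<open>f\<close> already, and this is never undone, or leave the point for the later
  factors.\<close>

lemma descending_maps_combine:
  assumes "finite F" and "\<And>h. h \<in> F \<Longrightarrow> descending_map X K f h"
  shows "\<exists>h. descending_map X K f h \<and>
             (\<forall>x\<in>topspace X. (\<exists>h'\<in>F. f (h' x) < f x) \<longrightarrow> f (h x) < f x)"
  using assms
proof (induction F)
  case empty
  have "descending_map X K f id"
    using deformation_map_id[of X K] unfolding descending_map_def by simp
  then show ?case
    by blast
next
  case (insert k F)
  then obtain h where h: "descending_map X K f h"
      "\<forall>x\<in>topspace X. (\<exists>h'\<in>F. f (h' x) < f x) \<longrightarrow> f (h x) < f x"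
    by (metis insert_iff)
  have k: "descending_map X K f k"
    using insert.prems by auto
  have kX: "k x \<in> topspace X" if "x \<in> topspace X" for x
    using deformation_map_into[OF descending_map_imp_deformation_map[OF k] that] .
  show ?case
  proof (intro exI[of _ "h \<circ> k"] conjI ballI impI)
    have "deformation_map X K (h \<circ> k)"
      using h(1) k descending_map_imp_deformation_map deformation_map_compose by metis
    then show "descending_map X K f (h \<circ> k)"
      using h(1) k kX unfolding descending_map_def by (metis comp_apply less_trans)
    fix x assume x: "x \<in> topspace X" and "\<exists>h'\<in>insert k F. f (h' x) < f x"
    then consider "f (k x) < f x" | "k x = x" "\<exists>h'\<in>F. f (h' x) < f x"
      using k unfolding descending_map_def by auto
    then show "f ((h \<circ> k) x) < f x"
    proof cases
      case 1
      then show ?thesis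
        using descending_map_le[OF h(1) kX[OF x]] by simp
    next
      case 2
      then show ?thesis
        using h(2) x by simp
    qed
  qed
qed

text \<open>The points lowered by a fixed descending map form an open set, so finitely many of the
  given maps suffice for a compact set.\<close>

lemma descending_map_on_compact:
  assumes f: "continuous_map X euclideanreal f" and L: "compactin X L"
    and push: "\<And>p. p \<in> L \<Longrightarrow> \<exists>h. descending_map X K f h \<and> f (h p) < f p"
  shows "\<exists>h. descending_map X K f h \<and> (\<forall>x\<in>L. f (h x) < f x)"
proof -
  have LX: "L \<subseteq> topspace X"
    using L compactin_subset_topspace by blast
  obtain h where h: "\<And>p. p \<in> L \<Longrightarrow> descending_map X K f (h p) \<and> f (h p p) < f p"
    using push by metis
  define V where "V p = {x \<in> topspace X. f (h p x) - f x \<in> {..<0}}" for p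
  have open_V: "openin X (V p)" if "p \<in> L" for p
  proof -
    have "continuous_map X euclideanreal (f \<circ> h p)"
      using f h[OF that] descending_map_imp_deformation_map deformation_map_continuous
        continuous_map_compose by metis
    then have "continuous_map X euclideanreal (\<lambda>x. f (h p x) - f x)"
      using f unfolding o_def by (rule continuous_map_diff)
    from openin_continuous_map_preimage[OF this, of "{..<0}"] show ?thesis
      unfolding V_def by simp
  qed
  have "L \<subseteq> \<Union>(V ` L)"
    using h LX unfolding V_def by auto
  moreover have "openin X G" if "G \<in> V ` L" for G
    using that open_V by auto
  ultimately obtain T where T: "finite T" "T \<subseteq> V ` L" "L \<subseteq> \<Union>T"
    using compactinD[OF L, of "V ` L"] by auto
  then obtain F where F: "finite F" "F \<subseteq> L" "T = V ` F"
    by (meson finite_subset_image)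
  have "finite (h ` F)" and "\<And>k. k \<in> h ` F \<Longrightarrow> descending_map X K f k"
    using F h by auto
  then obtain k where k: "descending_map X K f k"
      and k_less: "\<forall>x\<in>topspace X. (\<exists>h'\<in>h ` F. f (h' x) < f x) \<longrightarrow> f (k x) < f x"
    using descending_maps_combine[of "h ` F" X K f] by metis
  have "f (k x) < f x" if x: "x \<in> L" for x
  proof -
    obtain p where "p \<in> F" "x \<in> V p"
      using x T(3) F(3) by auto
    then have "\<exists>h'\<in>h ` F. f (h' x) < f x"
      unfolding V_def by auto
    then show ?thesis
      using k_less x LX by blast
  qed
  then show ?thesis
    using k by blast
qed

section \<open>Climbing through the sublevel sets\<close>

text \<open>The maps are defined on all of \<open>X\<close>, and the piece of the cover that belongs to \<open>N\<close> is the
  preimage of \<open>N\<close>.  Global maps make pulling a cover back along a deformation a plain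
  composition, and a preimage automatically contains \<open>N\<close>.\<close>

definition sublevel_cover ::
  "'a topology \<Rightarrow> ('a \<Rightarrow> real) \<Rightarrow> real \<Rightarrow> 'a set set \<Rightarrow> bool" where
  "sublevel_cover X f a \<S> \<longleftrightarrow>
     (\<exists>g. (\<forall>N\<in>\<S>. deformation_map X N (g N)) \<and>
          (\<forall>x\<in>topspace X. f x \<le> a \<longrightarrow> (\<exists>N\<in>\<S>. g N x \<in> N)))"

lemma sublevel_cover_mono: "sublevel_cover X f b \<S> \<Longrightarrow> a \<le> b \<Longrightarrow> sublevel_cover X f a \<S>"
  unfolding sublevel_cover_def by (elim exE, rule exI) (auto dest: order_trans)

text \<open>The step across a level \<open>c\<close>, critical or not.  Outside a neighbourhood \<open>O'\<close> of the critical
  sets at level \<open>c\<close>, a descending map \<open>h\<close> strictly lowers \<open>f\<close> on the compact set of points with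
  value \<open>c\<close>.  Compactness turns this into a uniform gap \<open>\<epsilon>\<close>: a point outside \<open>O'\<close> with value at
  most \<open>c + \<epsilon>\<close> is sent below \<open>c - \<epsilon>\<close>.  Old critical sets keep their
  maps, precomposed with \<open>h\<close>; those at level \<open>c\<close> receive the maps that carry \<open>O'\<close> into them.\<close>

lemma sublevel_cover_cross:
  fixes f :: "'a \<Rightarrow> real" and v :: "'a set \<Rightarrow> real"
  assumes X: "compact_space X" and f: "continuous_map X euclideanreal f"
    and push: "\<And>p. p \<in> topspace X - \<Union>\<N> \<Longrightarrow>
      \<exists>h. descending_map X (\<Union>\<N>) f h \<and> f (h p) < f p"
    and nbhd: "\<And>N. N \<in> \<N> \<Longrightarrow> \<exists>g W. deformation_map X N g \<and> openin X W \<and> N \<subseteq> W \<and> g ` W \<subseteq> N"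
    and v: "\<And>N x. N \<in> \<N> \<Longrightarrow> x \<in> N \<Longrightarrow> f x = v N"
  shows "\<exists>\<epsilon>>0. \<forall>\<S>. \<S> \<subseteq> \<N> \<longrightarrow> (\<forall>N\<in>\<S>. v N \<noteq> c) \<longrightarrow> sublevel_cover X f (c - \<epsilon>) \<S> \<longrightarrow>
           sublevel_cover X f (c + \<epsilon>) (\<S> \<union> {N \<in> \<N>. v N = c})"
proof -
  define \<N>c where "\<N>c = {N \<in> \<N>. v N = c}"
  obtain r W where r: "\<And>N. N \<in> \<N> \<Longrightarrow>
      deformation_map X N (r N) \<and> openin X (W N) \<and> N \<subseteq> W N \<and> r N ` W N \<subseteq> N"
    using nbhd by metis
  note r_deform = r[THEN conjunct1] and W_open = r[THEN conjunct2, THEN conjunct1]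
    and W_sub = r[THEN conjunct2, THEN conjunct2, THEN conjunct1]
    and r_into = r[THEN conjunct2, THEN conjunct2, THEN conjunct2]
  define O' where "O' = (\<Union>N\<in>\<N>c. W N)"
  have O': "openin X O'"
    unfolding O'_def \<N>c_def by (intro openin_Union) (auto intro: W_open)
  have comp: "compactin X (topspace X - O')"
    using X O' by (simp add: closedin_compact_space closedin_diff)
  have "closedin X {x \<in> topspace X. f x \<in> {c}}"
    using closedin_continuous_map_preimage[OF f, of "{c}"] by simp
  then have "closedin X ({x \<in> topspace X. f x \<in> {c}} - O')"
    using O' closedin_diff by blast
  then have L: "compactin X ({x \<in> topspace X. f x \<in> {c}} - O')"
    using X closedin_compact_space by blast
  have "\<exists>h. descending_map X (\<Union>\<N>) f h \<and> (\<forall>x\<in>{x \<in> topspace X. f x \<in> {c}} - O'. f (h x) < f x)"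
  proof (rule descending_map_on_compact[OF f L])
    fix p assume p: "p \<in> {x \<in> topspace X. f x \<in> {c}} - O'"
    have "N \<in> \<N>c" if "N \<in> \<N>" "p \<in> N" for N
      using p v[OF that] that(1) unfolding \<N>c_def by simp
    then have "p \<in> O'" if "N \<in> \<N>" "p \<in> N" for N
      using that W_sub[of N] unfolding O'_def by blast
    then have "p \<in> topspace X - \<Union>\<N>"
      using p by blast
    then show "\<exists>h. descending_map X (\<Union>\<N>) f h \<and> f (h p) < f p"
      by (rule push)
  qed
  then obtain h where h: "descending_map X (\<Union>\<N>) f h"
      and h_less: "\<forall>x\<in>{x \<in> topspace X. f x \<in> {c}} - O'. f (h x) < f x"
    by blast
  note h_deform = descending_map_imp_deformation_map[OF h]
  \<comment> \<open>A point outside \<open>O'\<close> violates the claimed gap \<open>\<epsilon>\<close> only if \<open>m x \<le> \<epsilon>\<close>.\<close>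
  define m where "m x = max (f x - c) (c - f (h x))" for x
  have m_pos: "m x > 0" if "x \<in> topspace X" "x \<notin> O'" for x
  proof -
    have "f x = c \<Longrightarrow> f (h x) < c"
      using h_less that by auto
    then show ?thesis
      using descending_map_le[OF h that(1)] unfolding m_def by linarith
  qed
  have "continuous_map X euclideanreal (f \<circ> h)"
    by (rule continuous_map_compose[OF deformation_map_continuous[OF h_deform] f])
  then have "continuous_map X euclideanreal m"
    unfolding m_def[abs_def] o_def
    by (intro continuous_map_real_max continuous_map_diff f) auto
  then have "compactin euclideanreal (m ` (topspace X - O'))"
    by (rule image_compactin[OF comp])
  then have cm: "compact (m ` (topspace X - O'))"
    by simp
  obtain \<epsilon> where \<epsilon>: "\<epsilon> > 0" "\<And>x. x \<in> topspace X \<Longrightarrow> x \<notin> O' \<Longrightarrow> m x > \<epsilon>"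
  proof (cases "topspace X - O' = {}")
    case True
    then show ?thesis
      using that[of 1] by auto
  next
    case False
    then obtain s where s: "s \<in> m ` (topspace X - O')" "\<forall>t\<in>m ` (topspace X - O'). s \<le> t"
      using compact_attains_inf[OF cm] by blast
    then have "s > 0"
      using m_pos by auto
    then show ?thesis
      using that[of "s / 2"] s(2) by force
  qed
  have "sublevel_cover X f (c + \<epsilon>) (\<S> \<union> \<N>c)"
    if S: "\<S> \<subseteq> \<N>" "\<forall>N\<in>\<S>. v N \<noteq> c" and cov: "sublevel_cover X f (c - \<epsilon>) \<S>" for \<S>
  proof -
    obtain g where g: "\<forall>N\<in>\<S>. deformation_map X N (g N)"
        "\<forall>x\<in>topspace X. f x \<le> c - \<epsilon> \<longrightarrow> (\<exists>N\<in>\<S>. g N x \<in> N)"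
      using cov unfolding sublevel_cover_def by blast
    define k where "k N = (if N \<in> \<N>c then r N else g N \<circ> h)" for N
    have kS: "k N = g N \<circ> h" if "N \<in> \<S>" for N
      using that S unfolding k_def \<N>c_def by auto
    show ?thesis
      unfolding sublevel_cover_def
    proof (intro exI[of _ k] conjI ballI impI)
      fix N assume "N \<in> \<S> \<union> \<N>c"
      then show "deformation_map X N (k N)"
      proof
        assume N: "N \<in> \<S>"
        then have "deformation_map X N h"
          using S deformation_map_mono[OF h_deform] by (metis Union_upper subsetD)
        then show ?thesis
          using N g kS deformation_map_compose by metis
      next
        assume "N \<in> \<N>c"
        then show ?thesis
          using r_deform unfolding k_def \<N>c_def by simp
      qed
    next
      fix x assume x: "x \<in> topspace X" "f x \<le> c + \<epsilon>"
      show "\<exists>N\<in>\<S> \<union> \<N>c. k N x \<in> N"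
      proof (cases "x \<in> O'")
        case True
        then obtain N where N: "N \<in> \<N>c" "x \<in> W N"
          unfolding O'_def by blast
        then have "k N x \<in> N"
          using r_into[of N] unfolding k_def \<N>c_def by auto
        then show ?thesis
          using N(1) by blast
      next
        case False
        have "f (h x) \<le> c - \<epsilon>"
          using \<epsilon>(2)[OF x(1) False] x(2) unfolding m_def by (auto simp: max_def split: if_splits)
        then obtain N where "N \<in> \<S>" "g N (h x) \<in> N"
          using g(2) deformation_map_into[OF h_deform x(1)] by blast
        then show ?thesis
          using kS by (intro bexI[of _ N]) auto
      qed
    qed
  qed
  then show ?thesis
    using \<epsilon>(1) unfolding \<N>c_def by metis
qed

text \<open>Induction over the critical values.  Between consecutive critical values the cover is
  carried along by \<open>sublevel_cover_cross\<close> with no new critical set, where Bolzano's principle on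
  real intervals chains the local steps together.\<close>

lemma critical_sets_cover:
  fixes f :: "'a \<Rightarrow> real" and v :: "'a set \<Rightarrow> real"
  assumes X: "compact_space X" and f: "continuous_map X euclideanreal f" and fin: "finite \<N>"
    and push: "\<And>p. p \<in> topspace X - \<Union>\<N> \<Longrightarrow>
      \<exists>h. descending_map X (\<Union>\<N>) f h \<and> f (h p) < f p"
    and nbhd: "\<And>N. N \<in> \<N> \<Longrightarrow> \<exists>g W. deformation_map X N g \<and> openin X W \<and> N \<subseteq> W \<and> g ` W \<subseteq> N"
    and v: "\<And>N x. N \<in> \<N> \<Longrightarrow> x \<in> N \<Longrightarrow> f x = v N"
  shows "\<exists>g. (\<forall>N\<in>\<N>. deformation_map X N (g N)) \<and> (\<forall>x\<in>topspace X. \<exists>N\<in>\<N>. g N x \<in> N)"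
proof -
  have cross: "\<exists>\<epsilon>>0. \<forall>\<S>. \<S> \<subseteq> \<N> \<longrightarrow> (\<forall>N\<in>\<S>. v N \<noteq> c) \<longrightarrow> sublevel_cover X f (c - \<epsilon>) \<S> \<longrightarrow>
           sublevel_cover X f (c + \<epsilon>) (\<S> \<union> {N \<in> \<N>. v N = c})" for c
    by (rule sublevel_cover_cross[OF X f push nbhd v])
  \<comment> \<open>Without critical values in between, the same critical sets suffice for the larger level.\<close>
  have stay: "sublevel_cover X f a \<S> \<longrightarrow> sublevel_cover X f b \<S>"
    if ab: "a \<le> b" and no: "\<And>N. N \<in> \<N> \<Longrightarrow> v N < a \<or> b < v N" and S: "\<S> \<subseteq> \<N>" for a b \<S>
    using ab
  proof (induction rule: Bolzano)
    case (trans a b c)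
    then show ?case
      by blast
  next
    case (local x)
    have "v N \<noteq> x" if "N \<in> \<N>" for N
      using no[OF that] local by auto
    then have empty: "{N \<in> \<N>. v N = x} = {}" and ne: "\<forall>N\<in>\<S>. v N \<noteq> x"
      using S by auto
    obtain \<epsilon> where \<epsilon>: "\<epsilon> > 0" "sublevel_cover X f (x - \<epsilon>) \<S> \<Longrightarrow> sublevel_cover X f (x + \<epsilon>) \<S>"
      using cross[of x] S ne unfolding empty Un_empty_right by blast
    show ?case
    proof (intro exI[of _ \<epsilon>] conjI allI impI \<epsilon>(1))
      fix a b assume ab: "a \<le> x \<and> x \<le> b \<and> b - a < \<epsilon>" and cov: "sublevel_cover X f a \<S>"
      have "sublevel_cover X f (x - \<epsilon>) \<S>"
        using ab by (intro sublevel_cover_mono[OF cov]) linarith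
      from \<epsilon>(2)[OF this] show "sublevel_cover X f b \<S>"
        by (rule sublevel_cover_mono) (use ab in linarith)
    qed
  qed
  have bdd: "compact (f ` topspace X)"
    using image_compactin[OF _ f, of "topspace X"] X unfolding compact_space_def by simp
  then obtain B where B: "\<And>x. x \<in> topspace X \<Longrightarrow> \<bar>f x\<bar> \<le> B"
    using compact_imp_bounded bounded_real by (metis imageI)
  have main: "sublevel_cover X f a {N \<in> \<N>. v N < a}" if "\<forall>N\<in>\<N>. v N \<noteq> a" for a
    using that
  proof (induction "card {N \<in> \<N>. v N < a}" arbitrary: a rule: less_induct)
    case less
    show ?case
    proof (cases "{N \<in> \<N>. v N < a} = {}")
      case True
      define b where "b = min a (- B - 1)"
      have "\<not> f x \<le> b" if "x \<in> topspace X" for x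
        using B[OF that] unfolding b_def by linarith
      then have "sublevel_cover X f b {}"
        unfolding sublevel_cover_def by simp
      moreover have "v N < b \<or> a < v N" if "N \<in> \<N>" for N
        using True less.prems that by force
      ultimately show ?thesis
        using stay[of b a "{}"] unfolding True b_def by simp
    next
      case False
      define c where "c = Max (v ` {N \<in> \<N>. v N < a})"
      have "c \<in> v ` {N \<in> \<N>. v N < a}"
        unfolding c_def using fin False by (intro Max_in) auto
      then obtain N0 where N0: "N0 \<in> \<N>" "v N0 = c" "c < a"
        by auto
      have c_max: "v N \<le> c" if "N \<in> \<N>" "v N < a" for N
        unfolding c_def using fin that by (intro Max_ge) auto
      obtain \<epsilon> where \<epsilon>: "\<epsilon> > 0" "\<And>\<S>. \<S> \<subseteq> \<N> \<Longrightarrow> (\<forall>N\<in>\<S>. v N \<noteq> c) \<Longrightarrow> sublevel_cover X f (c - \<epsilon>) \<S> \<Longrightarrow>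
           sublevel_cover X f (c + \<epsilon>) (\<S> \<union> {N \<in> \<N>. v N = c})"
        using cross[of c] by blast
      \<comment> \<open>Choose \<open>e\<close> below \<open>c\<close> but above \<open>c - \<epsilon>\<close> and above all smaller critical values.\<close>
      define d where "d = Max (insert (c - \<epsilon>) (v ` {N \<in> \<N>. v N < c}))"
      have finI: "finite (insert (c - \<epsilon>) (v ` {N \<in> \<N>. v N < c}))"
        using fin by simp
      have "d < c"
        unfolding d_def using finI \<epsilon>(1) by (subst Max_less_iff) auto
      have d_ge: "c - \<epsilon> \<le> d" "\<And>N. N \<in> \<N> \<Longrightarrow> v N < c \<Longrightarrow> v N \<le> d"
        unfolding d_def using finI by (auto intro!: Max_ge)
      define e where "e = (c + d) / 2"
      have e: "d < e" "e < c"
        using \<open>d < c\<close> unfolding e_def by auto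
      have eq: "{N \<in> \<N>. v N < e} = {N \<in> \<N>. v N < c}"
        using d_ge e by force
      have "card {N \<in> \<N>. v N < e} < card {N \<in> \<N>. v N < a}"
        unfolding eq using fin N0 by (intro psubset_card_mono) auto
      moreover have "\<forall>N\<in>\<N>. v N \<noteq> e"
        using d_ge e by force
      ultimately have "sublevel_cover X f e {N \<in> \<N>. v N < c}"
        using less.hyps unfolding eq[symmetric] by blast
      then have "sublevel_cover X f (c - \<epsilon>) {N \<in> \<N>. v N < c}"
        by (rule sublevel_cover_mono) (use d_ge(1) e(1) in linarith)
      then have "sublevel_cover X f (c + \<epsilon>) ({N \<in> \<N>. v N < c} \<union> {N \<in> \<N>. v N = c})"
        by (intro \<epsilon>(2)) auto
      moreover have "{N \<in> \<N>. v N < c} \<union> {N \<in> \<N>. v N = c} = {N \<in> \<N>. v N < a}"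
        using c_max N0 by force
      ultimately have cov: "sublevel_cover X f (c + \<epsilon>) {N \<in> \<N>. v N < a}"
        by simp
      show ?thesis
      proof (cases "a \<le> c + \<epsilon>")
        case True
        then show ?thesis
          using sublevel_cover_mono[OF cov] by simp
      next
        case a: False
        have "v N < c + \<epsilon> \<or> a < v N" if "N \<in> \<N>" for N
          using c_max[OF that] less.prems that \<epsilon>(1) by force
        then show ?thesis
          using stay[of "c + \<epsilon>" a "{N \<in> \<N>. v N < a}"] cov a by auto
      qed
    qed
  qed
  define a where "a = Max (insert B (v ` \<N>)) + 1"
  have "y < a" if "y \<in> insert B (v ` \<N>)" for y
    using Max_ge[OF _ that] fin unfolding a_def by simp
  then have "B < a" "\<And>N. N \<in> \<N> \<Longrightarrow> v N < a"
    by auto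
  then have "{N \<in> \<N>. v N < a} = \<N>" and "\<forall>N\<in>\<N>. v N \<noteq> a"
    by (auto simp: less_le)
  then have cov: "sublevel_cover X f a \<N>"
    using main[of a] by simp
  have "f x \<le> a" if "x \<in> topspace X" for x
    using B[OF that] \<open>B < a\<close> by linarith
  then show ?thesis
    using cov unfolding sublevel_cover_def by auto
qed

section \<open>Pushes supported in a chart\<close>

lemma continuous_map_scaleR:
  fixes g :: "'a \<Rightarrow> 'b::real_normed_vector"
  assumes "continuous_map X euclideanreal a" and "continuous_map X euclidean g"
  shows "continuous_map X euclidean (\<lambda>x. a x *\<^sub>R g x)"
  using assms by (simp add: continuous_map_atin tendsto_scaleR)

text \<open>\<open>inv_into U \<phi>\<close> agrees on the chart image with the continuous inverse.\<close>

lemma chart_inverse: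
  assumes U: "openin X U" and hom: "homeomorphic_map (subtopology X U) (top_of_set (\<phi> ` U)) \<phi>"
  shows "inj_on \<phi> U"
    and "continuous_map (subtopology X U) euclidean \<phi>"
    and "continuous_map (top_of_set (\<phi> ` U)) X (inv_into U \<phi>)"
proof -
  have top: "topspace (subtopology X U) = U"
    using openin_subset[OF U] by auto
  show inj: "inj_on \<phi> U"
    using homeomorphic_imp_injective_map[OF hom] top by simp
  show "continuous_map (subtopology X U) euclidean \<phi>"
    using homeomorphic_imp_continuous_map[OF hom] continuous_map_in_subtopology by blast
  obtain \<psi> where "homeomorphic_maps (subtopology X U) (top_of_set (\<phi> ` U)) \<phi> \<psi>"
    using hom unfolding homeomorphic_map_maps by blast
  then have \<psi>: "continuous_map (top_of_set (\<phi> ` U)) X \<psi>" "\<And>x. x \<in> U \<Longrightarrow> \<psi> (\<phi> x) = x"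
    unfolding homeomorphic_maps_def continuous_map_in_subtopology using top by auto
  have "\<psi> y = inv_into U \<phi> y" if "y \<in> topspace (top_of_set (\<phi> ` U))" for y
    using that \<psi>(2) inj by auto
  then show "continuous_map (top_of_set (\<phi> ` U)) X (inv_into U \<phi>)"
    using \<psi>(1) continuous_map_eq by blast
qed

lemma chart_preimage_open:
  assumes "openin X U" and "homeomorphic_map (subtopology X U) (top_of_set (\<phi> ` U)) \<phi>" and "open G"
  shows "openin X {x \<in> U. \<phi> x \<in> G}"
proof -
  have "openin (subtopology X U) {x \<in> topspace (subtopology X U). \<phi> x \<in> G}"
    using openin_continuous_map_preimage[OF chart_inverse(2)[OF assms(1,2)], of G] assms(3) by simp
  moreover have "topspace (subtopology X U) = U"
    using openin_subset[OF assms(1)] by auto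
  ultimately show ?thesis
    using openin_trans_full assms(1) by metis
qed

text \<open>A self-map \<open>q\<close> of a chart image that is supported in a compact set and moves each point along
  a segment inside the image extends by the identity to a map of the whole space.  The
  straight-line homotopy, glued with the constant one, is continuous because the support is
  compact, hence closed in the Hausdorff space, so that the two formulas live on two open sets
  covering the product.\<close>

lemma chart_push_homotopic_id:
  fixes \<phi> :: "'a \<Rightarrow> 'e::euclidean_space"
  assumes X: "Hausdorff_space X" and U: "openin X U"
    and hom: "homeomorphic_map (subtopology X U) (top_of_set (\<phi> ` U)) \<phi>"
    and D: "compact D" "D \<subseteq> \<phi> ` U"
    and q: "continuous_on (\<phi> ` U) q"
    and seg: "\<And>y t. y \<in> \<phi> ` U \<Longrightarrow> 0 \<le> t \<Longrightarrow> t \<le> 1 \<Longrightarrow> y + t *\<^sub>R (q y - y) \<in> \<phi> ` U"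
    and fixed: "\<And>y. y \<in> \<phi> ` U \<Longrightarrow> y \<notin> D \<Longrightarrow> q y = y"
  shows "homotopic_with (\<lambda>_. True) X X id (\<lambda>x. if x \<in> U then inv_into U \<phi> (q (\<phi> x)) else x)"
proof -
  define \<psi> where "\<psi> = inv_into U \<phi>"
  note inj = chart_inverse(1)[OF U hom] and cont_\<phi> = chart_inverse(2)[OF U hom]
    and cont_\<psi> = chart_inverse(3)[OF U hom, folded \<psi>_def]
  have \<psi>\<phi>: "\<psi> (\<phi> x) = x" if "x \<in> U" for x
    using that inj unfolding \<psi>_def by simp
  have UX: "U \<subseteq> topspace X"
    using U openin_subset by blast
  define H where "H z = (if snd z \<in> U then \<psi> (\<phi> (snd z) + fst z *\<^sub>R (q (\<phi> (snd z)) - \<phi> (snd z)))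
                         else snd z)" for z :: "real \<times> 'a"
  let ?I = "top_of_set {0..1::real}"
  let ?P = "prod_topology ?I X"
  have "compactin (top_of_set (\<phi> ` U)) D"
    using D by (simp add: compactin_subtopology)
  then have "compactin X (\<psi> ` D)"
    using cont_\<psi> image_compactin by blast
  then have closed_D: "closedin X (\<psi> ` D)"
    using X compactin_imp_closedin by blast
  \<comment> \<open>The homotopy is given by charts on \<open>?A\<close> and stationary on \<open>?B\<close>.\<close>
  let ?A = "{0..1} \<times> U" and ?B = "{0..1} \<times> (topspace X - \<psi> ` D)"
  have A: "openin ?P ?A"
    using U by (simp add: openin_prod_Times_iff)
  have B: "openin ?P ?B"
    using closed_D by (simp add: openin_prod_Times_iff openin_diff)
  have cover: "topspace ?P = ?A \<union> ?B"
    using UX D(2) \<psi>\<phi> by auto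
  have HB: "H z = snd z" if "z \<in> ?B" for z
  proof (cases "snd z \<in> U")
    case True
    have "\<phi> (snd z) \<notin> D"
    proof
      assume "\<phi> (snd z) \<in> D"
      then have "\<psi> (\<phi> (snd z)) \<in> \<psi> ` D"
        by (rule imageI)
      then show False
        using True \<psi>\<phi> that by auto
    qed
    then show ?thesis
      using True fixed \<psi>\<phi> unfolding H_def by simp
  qed (simp add: H_def)
  have contB: "continuous_map (subtopology ?P ?B) X H"
    by (rule continuous_map_eq[of _ _ snd])
      (auto simp: HB continuous_map_from_subtopology continuous_map_snd)
  define L where "L z = \<phi> (snd z) + fst z *\<^sub>R (q (\<phi> (snd z)) - \<phi> (snd z))" for z :: "real \<times> 'a"
  have subA: "subtopology ?P ?A = prod_topology ?I (subtopology X U)"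
    by (simp add: subtopology_Times subtopology_subtopology)
  have c\<phi>: "continuous_map (subtopology ?P ?A) (top_of_set (\<phi> ` U)) (\<lambda>z. \<phi> (snd z))"
    unfolding subA
  proof -
    have "continuous_map (prod_topology ?I (subtopology X U)) (top_of_set (\<phi> ` U)) (\<phi> \<circ> snd)"
      using continuous_map_snd homeomorphic_imp_continuous_map[OF hom] by (rule continuous_map_compose)
    then show "continuous_map (prod_topology ?I (subtopology X U)) (top_of_set (\<phi> ` U)) (\<lambda>z. \<phi> (snd z))"
      by (simp add: o_def)
  qed
  have "continuous_map (top_of_set (\<phi> ` U)) euclidean q"
    using q by simp
  from continuous_map_compose[OF c\<phi> this]
  have cq: "continuous_map (subtopology ?P ?A) euclidean (\<lambda>z. q (\<phi> (snd z)))"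
    by (simp add: o_def)
  have c\<phi>': "continuous_map (subtopology ?P ?A) euclidean (\<lambda>z. \<phi> (snd z))"
    using c\<phi> continuous_map_in_subtopology by blast
  have "continuous_map ?P ?I fst"
    by (rule continuous_map_fst)
  then have cf: "continuous_map (subtopology ?P ?A) euclideanreal fst"
    using continuous_map_from_subtopology continuous_map_in_subtopology by blast
  have cL: "continuous_map (subtopology ?P ?A) euclidean L"
    unfolding L_def[abs_def]
    by (intro continuous_map_add continuous_map_diff c\<phi>' cq continuous_map_scaleR cf)
  have "L ` topspace (subtopology ?P ?A) \<subseteq> \<phi> ` U"
    using seg unfolding L_def by auto
  then have "continuous_map (subtopology ?P ?A) (top_of_set (\<phi> ` U)) L"
    using cL by (simp add: continuous_map_in_subtopology image_subset_iff_funcset)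
  from continuous_map_compose[OF this cont_\<psi>]
  have contA: "continuous_map (subtopology ?P ?A) X H"
    by (rule continuous_map_eq) (auto simp: H_def L_def)
  have "continuous_map ?P X H"
    unfolding continuous_map_def
  proof (intro conjI allI impI)
    show "H \<in> topspace ?P \<rightarrow> topspace X"
    proof
      fix z assume "z \<in> topspace ?P"
      then consider "z \<in> topspace (subtopology ?P ?A)" | "z \<in> topspace (subtopology ?P ?B)"
        using cover by auto
      then show "H z \<in> topspace X"
        by cases (use contA contB in \<open>auto simp: continuous_map_def\<close>)
    qed
    fix G assume G: "openin X G"
    have "openin ?P {z \<in> ?A. H z \<in> G}" "openin ?P {z \<in> ?B. H z \<in> G}"
      using openin_continuous_map_preimage[OF contA G] openin_continuous_map_preimage[OF contB G]
        openin_trans_full A B openin_subset[OF A] openin_subset[OF B]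
      by (auto simp: Int_absorb1 simp del: topspace_prod_topology)
    moreover have "{z \<in> topspace ?P. H z \<in> G} = {z \<in> ?A. H z \<in> G} \<union> {z \<in> ?B. H z \<in> G}"
      using cover by blast
    ultimately show "openin ?P {z \<in> topspace ?P. H z \<in> G}"
      by auto
  qed
  moreover have "H (0, x) = id x" for x
    using \<psi>\<phi> unfolding H_def by simp
  moreover have "H (1, x) = (if x \<in> U then \<psi> (q (\<phi> x)) else x)" for x
    unfolding H_def by simp
  ultimately show ?thesis
    unfolding homotopic_with_def \<psi>_def by blast
qed

section \<open>Derivatives on pieces of half-spaces\<close>

lemma directional_DERIV:
  fixes g :: "'e::real_normed_vector \<Rightarrow> real"
  assumes "g differentiable (at (x + s *\<^sub>R v))"
  shows "((\<lambda>s. g (x + s *\<^sub>R v)) has_real_derivative frechet_derivative g (at (x + s *\<^sub>R v)) v) (at s)"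
proof -
  let ?D = "frechet_derivative g (at (x + s *\<^sub>R v))"
  have D: "(g has_derivative ?D) (at (x + s *\<^sub>R v))"
    using assms frechet_derivative_works by blast
  have "((\<lambda>s. x + s *\<^sub>R v) has_derivative (\<lambda>t. t *\<^sub>R v)) (at s)"
    by (auto intro!: derivative_eq_intros)
  then have "((\<lambda>s. g (x + s *\<^sub>R v)) has_derivative (\<lambda>t. ?D (t *\<^sub>R v))) (at s)"
    using D by (rule has_derivative_compose)
  moreover have "?D (t *\<^sub>R v) = ?D v * t" for t
    using linear_scale[OF has_derivative_linear[OF D]] by (simp add: mult.commute)
  ultimately show ?thesis
    unfolding has_field_derivative_def by simp
qed

lemma C1_on_local_extension:
  fixes F :: "'e::euclidean_space \<Rightarrow> 'b::real_normed_vector"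
  assumes "C_k_on k S F" and "x \<in> S" and "1 \<le> k"
  obtains G g where "open G" "x \<in> G" "\<And>y. y \<in> G \<Longrightarrow> g differentiable (at y)"
    "\<And>v. continuous_on G (\<lambda>y. frechet_derivative g (at y) v)" "\<And>y. y \<in> S \<inter> G \<Longrightarrow> g y = F y"
    "\<And>y. y \<in> S \<inter> G \<Longrightarrow> (F has_derivative frechet_derivative g (at y)) (at y within S)"
proof -
  obtain G g where G: "open G" "x \<in> G" and gk: "\<forall>j. enat j \<le> k \<longrightarrow> C_k_open j G g"
    and gF: "\<forall>y\<in>S \<inter> G. g y = F y"
    using assms unfolding C_k_on_def by blast
  have "C_k_open (Suc 0) G g"
    using gk assms(3) by (metis One_nat_def one_enat_def)
  then have g: "\<And>y. y \<in> G \<Longrightarrow> g differentiable (at y)"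
      "\<And>v. continuous_on G (\<lambda>y. frechet_derivative g (at y) v)"
    by auto
  have "(F has_derivative frechet_derivative g (at y)) (at y within S)" if y: "y \<in> S \<inter> G" for y
  proof -
    obtain d where d: "d > 0" "ball y d \<subseteq> G"
      using G(1) y open_contains_ball by blast
    have "(g has_derivative frechet_derivative g (at y)) (at y within S)"
      using g(1) y frechet_derivative_works has_derivative_at_withinI by blast
    then show ?thesis
    proof (rule has_derivative_transform_within[OF _ d(1)])
      fix z assume "z \<in> S" "dist z y < d"
      then have "z \<in> S \<inter> G"
        using d(2) by (auto simp: dist_commute)
      then show "g z = F z"
        using gF by blast
    qed (use y in auto)
  qed
  then show ?thesis
    using that G g gF by blast
qed

lemma C1_on_has_derivative:
  assumes "C_k_on k S F" and "x \<in> S" and "1 \<le> k"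
  shows "\<exists>D. (F has_derivative D) (at x within S)"
  by (rule C1_on_local_extension[OF assms]) (use assms(2) in blast)

text \<open>The set \<open>S\<close> need not be open, so only one-sided derivatives along segments starting at \<open>x\<close>
  are available; this is enough at boundary points of a half-space.\<close>

lemma derivative_along_segment:
  fixes F :: "'e::real_normed_vector \<Rightarrow> real"
  assumes D: "(F has_derivative D) (at x within S)"
    and seg: "\<And>s. 0 \<le> s \<Longrightarrow> s < e \<Longrightarrow> x + s *\<^sub>R v \<in> S"
  shows "((\<lambda>s. F (x + s *\<^sub>R v)) has_real_derivative D v) (at 0 within {0..<e})"
proof -
  let ?\<gamma> = "\<lambda>s::real. x + s *\<^sub>R v"
  have path: "(?\<gamma> has_derivative (\<lambda>t. t *\<^sub>R v)) (at 0 within {0..<e})"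
    by (auto intro!: derivative_eq_intros)
  have "?\<gamma> ` {0..<e} \<subseteq> S"
    using seg by auto
  then have "(F has_derivative D) (at (?\<gamma> 0) within ?\<gamma> ` {0..<e})"
    using has_derivative_subset[OF D] by simp
  from diff_chain_within[OF path this]
  have "((\<lambda>s. F (?\<gamma> s)) has_derivative (\<lambda>t. D (t *\<^sub>R v))) (at 0 within {0..<e})"
    by (simp add: o_def)
  moreover have "(\<lambda>t. D (t *\<^sub>R v)) = (*) (D v)"
    using linear_scale[OF has_derivative_linear[OF D]] by (auto simp: mult.commute)
  ultimately show ?thesis
    unfolding has_field_derivative_def by simp
qed

lemma zero_derivative_along_direction:
  fixes F :: "'e::real_normed_vector \<Rightarrow> real"
  assumes D: "(F has_derivative D) (at x within S)" and Z: "(F has_derivative (\<lambda>_. 0)) (at x within S)"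
    and e: "e > 0" and seg: "\<And>s. 0 \<le> s \<Longrightarrow> s < e \<Longrightarrow> x + s *\<^sub>R v \<in> S"
  shows "D v = 0"
proof -
  have "at (0::real) within {0..<e} \<noteq> bot"
    using e by (simp add: trivial_limit_within islimpt_Ico)
  moreover have "((\<lambda>s. F (x + s *\<^sub>R v)) has_vector_derivative D v) (at 0 within {0..<e})"
    "((\<lambda>s. F (x + s *\<^sub>R v)) has_vector_derivative 0) (at 0 within {0..<e})"
    using derivative_along_segment[OF D seg] derivative_along_segment[OF Z seg]
    by (auto simp: has_real_derivative_iff_has_vector_derivative)
  ultimately show ?thesis
    by (rule vector_derivative_unique_within)
qed

text \<open>Difference quotients within \<open>S\<close> only see directions in \<open>span B\<close>, although the derivative is
  a linear map on the whole Euclidean type.\<close>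

lemma has_derivative_zero_within_span:
  fixes F :: "'e::euclidean_space \<Rightarrow> real"
  assumes D: "(F has_derivative D) (at x within S)" and S: "S \<subseteq> span B" "x \<in> S"
    and zero: "\<And>v. v \<in> span B \<Longrightarrow> D v = 0"
  shows "(F has_derivative (\<lambda>_. 0)) (at x within S)"
proof -
  have "D (y - x) = 0" if "y \<in> S" for y
    using zero that S span_diff by (metis subsetD)
  then have ev: "\<forall>\<^sub>F y in at x within S. (1 / norm (y - x)) *\<^sub>R (F y - (F x + D (y - x))) =
               (1 / norm (y - x)) *\<^sub>R (F y - (F x + 0))"
    by (simp add: eventually_at_filter)
  have "((\<lambda>y. (1 / norm (y - x)) *\<^sub>R (F y - (F x + D (y - x)))) \<longlongrightarrow> 0) (at x within S)"
    using D unfolding has_derivative_within by blast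
  then have "((\<lambda>y. (1 / norm (y - x)) *\<^sub>R (F y - (F x + 0))) \<longlongrightarrow> 0) (at x within S)"
    by (rule tendsto_cong[OF ev, THEN iffD1])
  then show ?thesis
    unfolding has_derivative_within using bounded_linear_zero by blast
qed

text \<open>A half-space chart looks like the full model space around any point off the bounding
  hyperplane, so only points on the hyperplane need separate treatment.\<close>

lemma model_space_near:
  fixes x :: "'e::euclidean_space"
  assumes B: "B \<subseteq> Basis" and x: "x \<in> S"
    and S: "openin (top_of_set (span B)) S \<or> (\<exists>b\<in>B. openin (top_of_set (half_space B b)) S)"
  shows "(\<exists>r>0. S \<inter> cball x r = span B \<inter> cball x r) \<or>
         (\<exists>b\<in>B. openin (top_of_set (half_space B b)) S \<and> x \<bullet> b = 0 \<and>
            (\<exists>r>0. S \<inter> cball x r = half_space B b \<inter> cball x r))"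
proof -
  have near: "\<exists>r>0. S \<inter> cball x r = H \<inter> cball x r" if "openin (top_of_set H) S" for H
  proof -
    have "\<exists>T. open T \<and> S = H \<inter> T"
      using that unfolding openin_open .
    then obtain T where T: "open T" "S = H \<inter> T"
      by (elim exE conjE)
    obtain r where "r > 0" "cball x r \<subseteq> T"
      using T x open_contains_cball by blast
    then show ?thesis
      using T by (intro exI[of _ r]) auto
  qed
  show ?thesis
  proof (cases "openin (top_of_set (span B)) S")
    case True
    then show ?thesis
      using near by blast
  next
    case False
    then obtain b where b: "b \<in> B" "openin (top_of_set (half_space B b)) S"
      using S by blast
    obtain r where r: "r > 0" "S \<inter> cball x r = half_space B b \<inter> cball x r"
      using near[OF b(2)] by blast
    show ?thesis
    proof (cases "x \<bullet> b = 0")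
      case True
      then show ?thesis
        using b r by blast
    next
      case False
      have "x \<in> half_space B b"
        using x b(2) openin_imp_subset by blast
      then have pos: "x \<bullet> b > 0"
        using False unfolding half_space_def by auto
      have "open {y. 0 < y \<bullet> b}"
        by (simp add: open_Collect_less continuous_intros)
      then obtain d where d: "d > 0" "cball x d \<subseteq> {y. 0 < y \<bullet> b}"
        using pos open_contains_cball by blast
      have "S \<inter> cball x (min r d) = S \<inter> cball x r \<inter> cball x d"
        by auto
      also have "\<dots> = span B \<inter> cball x (min r d)"
        unfolding r(2) half_space_def using d(2) by (auto dest: subsetD)
      finally show ?thesis
        using r(1) d(1) by (intro disjI1 exI[of _ "min r d"]) auto
    qed
  qed
qed

section \<open>Charts, critical points and continuity\<close>

lemma chart_facts:
  assumes "is_chart B X (U, \<phi>)"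
  shows "openin X U" "homeomorphic_map (subtopology X U) (top_of_set (\<phi> ` U)) \<phi>" "inj_on \<phi> U"
    "openin (top_of_set (span B)) (\<phi> ` U) \<or> (\<exists>b\<in>B. openin (top_of_set (half_space B b)) (\<phi> ` U))"
    "\<phi> ` U \<subseteq> span B"
proof -
  show 1: "openin X U" "homeomorphic_map (subtopology X U) (top_of_set (\<phi> ` U)) \<phi>"
    "openin (top_of_set (span B)) (\<phi> ` U) \<or> (\<exists>b\<in>B. openin (top_of_set (half_space B b)) (\<phi> ` U))"
    using assms unfolding is_chart_def by auto
  show "inj_on \<phi> U"
    using chart_inverse(1) 1 by blast
  show "\<phi> ` U \<subseteq> span B"
    using 1(3) openin_imp_subset unfolding half_space_def by blast
qed

text \<open>The chain rule: the chart change is differentiable and its domain is relatively open, so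
  passing to the smaller set does not change the filter at the point.\<close>

lemma zero_derivative_change_chart:
  fixes \<phi> \<psi> :: "'a \<Rightarrow> 'e::euclidean_space" and f :: "'a \<Rightarrow> real"
  assumes \<phi>: "is_chart B X (U, \<phi>)" and \<psi>: "is_chart B X (V, \<psi>)"
    and comp: "compatible_charts (U, \<phi>) (V, \<psi>)" and p: "p \<in> U" "p \<in> V"
    and zero: "((f \<circ> inv_into U \<phi>) has_derivative (\<lambda>_. 0)) (at (\<phi> p) within \<phi> ` U)"
  shows "((f \<circ> inv_into V \<psi>) has_derivative (\<lambda>_. 0)) (at (\<psi> p) within \<psi> ` V)"
proof -
  note inj\<phi> = chart_facts(3)[OF \<phi>] and inj\<psi> = chart_facts(3)[OF \<psi>]
  let ?S = "\<psi> ` (U \<inter> V)"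
  let ?T = "\<phi> \<circ> inv_into V \<psi>"
  have "C_k_on \<infinity> ?S ?T"
    using comp unfolding compatible_charts_def by auto
  moreover have "\<psi> p \<in> ?S"
    using p by blast
  ultimately obtain D where T: "(?T has_derivative D) (at (\<psi> p) within ?S)"
    using C1_on_has_derivative[of \<infinity> ?S ?T] by auto
  have img: "?T ` ?S \<subseteq> \<phi> ` U"
    using inj\<psi> by auto
  have Tp: "?T (\<psi> p) = \<phi> p"
    using inj\<psi> p by simp
  have "((f \<circ> inv_into U \<phi>) has_derivative (\<lambda>_. 0)) (at (?T (\<psi> p)) within ?T ` ?S)"
    unfolding Tp using zero img by (rule has_derivative_subset)
  from diff_chain_within[OF T this]
  have "((f \<circ> inv_into U \<phi> \<circ> ?T) has_derivative (\<lambda>_. 0)) (at (\<psi> p) within ?S)"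
    by (simp add: o_def)
  then have S: "((f \<circ> inv_into V \<psi>) has_derivative (\<lambda>_. 0)) (at (\<psi> p) within ?S)"
    by (rule has_derivative_transform_within[of _ _ _ _ 1]) (use p inj\<phi> inj\<psi> in auto)
  have "openin (subtopology X V) (U \<inter> V)"
    using chart_facts(1)[OF \<phi>] by (metis Int_commute openin_subtopology_Int2)
  then have "openin (top_of_set (\<psi> ` V)) ?S"
    using homeomorphic_imp_open_map[OF chart_facts(2)[OF \<psi>]] unfolding open_map_def by blast
  then obtain O' where O': "open O'" "?S = \<psi> ` V \<inter> O'"
    unfolding openin_open by blast
  have "at (\<psi> p) within ?S = at (\<psi> p) within \<psi> ` V"
    using O' p by (intro at_within_nhd[of _ O']) auto
  then show ?thesis
    using S by simp
qed

text \<open>Being critical is defined through some chart of the atlas; a compatible chart, for instance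
  a slice chart outside the atlas, sees the same critical points.\<close>

lemma critical_in_chart:
  fixes f :: "'a \<Rightarrow> real"
  assumes M: "smooth_manifold B \<A> M" and \<psi>: "is_chart B M (V, \<psi>)"
    and comp: "\<forall>c\<in>\<A>. compatible_charts c (V, \<psi>)"
    and p: "p \<in> critical_points \<A> f" "p \<in> V"
  shows "((f \<circ> inv_into V \<psi>) has_derivative (\<lambda>_. 0)) (at (\<psi> p) within \<psi> ` V)"
proof -
  obtain U \<phi> where "(U, \<phi>) \<in> \<A>" "p \<in> U"
      "((f \<circ> inv_into U \<phi>) has_derivative (\<lambda>_. 0)) (at (\<phi> p) within \<phi> ` U)"
    using p(1) unfolding critical_points_def by blast
  moreover from this have "is_chart B M (U, \<phi>)"
    using M unfolding smooth_manifold_def by blast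
  ultimately show ?thesis
    using zero_derivative_change_chart \<psi> comp p(2) by metis
qed

lemma C1_function_continuous:
  assumes M: "smooth_manifold B \<A> M" and f: "C1_function \<A> f"
  shows "continuous_map M euclideanreal f"
  unfolding continuous_map_def
proof (intro conjI allI impI)
  fix G :: "real set" assume "openin euclidean G"
  then have G: "open G"
    by simp
  show "openin M {x \<in> topspace M. f x \<in> G}"
  proof (subst openin_subopen, intro ballI)
    fix p assume "p \<in> {x \<in> topspace M. f x \<in> G}"
    then have p: "p \<in> topspace M" "f p \<in> G"
      by auto
    obtain U \<phi> where U: "(U, \<phi>) \<in> \<A>" "p \<in> U"
      using M p(1) unfolding smooth_manifold_def by blast
    have ch: "is_chart B M (U, \<phi>)"
      using M U(1) unfolding smooth_manifold_def by blast
    note cf = chart_facts[OF ch]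
    let ?F = "f \<circ> inv_into U \<phi>"
    have C1: "C_k_on 1 (\<phi> ` U) ?F"
      using f U(1) unfolding C1_function_def by blast
    have "continuous_on (\<phi> ` U) ?F"
      unfolding continuous_on_eq_continuous_within
      using C1_on_has_derivative[OF C1] has_derivative_continuous by blast
    then obtain O' where O': "open O'" "O' \<inter> \<phi> ` U = ?F -` G \<inter> \<phi> ` U"
      using G unfolding continuous_on_open_invariant by meson
    have F: "?F (\<phi> x) = f x" if "x \<in> U" for x
      using that cf(3) by simp
    have "{x \<in> U. \<phi> x \<in> O'} \<subseteq> {x \<in> topspace M. f x \<in> G}"
    proof clarify
      fix x assume x: "x \<in> U" "\<phi> x \<in> O'"
      then have "\<phi> x \<in> ?F -` G"
        using O'(2) by blast
      then show "x \<in> topspace M \<and> f x \<in> G"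
        using F[OF x(1)] x(1) openin_subset[OF cf(1)] by auto
    qed
    moreover have "p \<in> {x \<in> U. \<phi> x \<in> O'}"
    proof -
      have "\<phi> p \<in> ?F -` G \<inter> \<phi> ` U"
        using F[OF U(2)] U(2) p(2) by simp
      then show ?thesis
        using O'(2) U(2) by blast
    qed
    ultimately show "\<exists>T. openin M T \<and> p \<in> T \<and> T \<subseteq> {x \<in> topspace M. f x \<in> G}"
      using chart_preimage_open[OF cf(1,2) O'(1)] by blast
  qed
qed auto

section \<open>Descending maps at regular points\<close>

text \<open>The derivative does not vanish on the model space, so \<open>w\<close> or \<open>- w\<close> is a direction of descent.
  At a boundary point the direction must not leave the half-space.  There \<open>f\<close> is maximal, so the
  derivative is nonpositive in every inward direction; whichever of \<open>w\<close> and \<open>- w\<close> points inwards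
  has nonzero, hence negative, derivative.  The set \<open>H\<close> is the model space or half-space that the
  chart image agrees with near the point.\<close>

lemma descent_direction_at_regular_point:
  fixes f :: "'a \<Rightarrow> real" and \<phi> :: "'a \<Rightarrow> 'e::euclidean_space"
  assumes M: "smooth_manifold B \<A> M"
    and bd: "\<forall>p\<in>manifold_boundary B \<A>. \<forall>x\<in>topspace M. f x \<le> f p"
    and U: "(U, \<phi>) \<in> \<A>" "p \<in> U" and reg: "p \<notin> critical_points \<A> f"
    and D: "((f \<circ> inv_into U \<phi>) has_derivative D) (at (\<phi> p) within \<phi> ` U)"
  obtains H r v where "closed H" "r > 0" "\<phi> ` U \<inter> cball (\<phi> p) r = H \<inter> cball (\<phi> p) r"
    "\<And>x s. x \<in> H \<Longrightarrow> 0 \<le> s \<Longrightarrow> x + s *\<^sub>R v \<in> H" "D v < 0"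
proof -
  let ?F = "f \<circ> inv_into U \<phi>" and ?S = "\<phi> ` U"
  have ch: "is_chart B M (U, \<phi>)" and B: "B \<subseteq> Basis"
    using M U(1) unfolding smooth_manifold_def by auto
  note cf = chart_facts[OF ch]
  have pS: "\<phi> p \<in> ?S"
    using U(2) by blast
  have "\<not> (?F has_derivative (\<lambda>_. 0)) (at (\<phi> p) within ?S)"
    using reg U unfolding critical_points_def by blast
  then obtain w where w: "w \<in> span B" "D w \<noteq> 0"
    using has_derivative_zero_within_span[OF D cf(5) pS] by blast
  have neg: "D (- w) = - D w"
    using linear_neg[OF has_derivative_linear[OF D]] .
  consider (interior) r where "r > 0" "?S \<inter> cball (\<phi> p) r = span B \<inter> cball (\<phi> p) r"
    | (boundary) b r where "b \<in> B" "openin (top_of_set (half_space B b)) ?S" "\<phi> p \<bullet> b = 0" "r > 0"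
        "?S \<inter> cball (\<phi> p) r = half_space B b \<inter> cball (\<phi> p) r"
    using model_space_near[OF B pS cf(4)] by blast
  then show ?thesis
  proof cases
    case interior
    define v where "v = (if D w < 0 then w else - w)"
    have "v \<in> span B" "D v < 0"
      using w neg span_neg unfolding v_def by (auto simp: span_neg)
    then show ?thesis
      using interior that[of "span B" r v] by (simp add: span_add span_scale)
  next
    case boundary
    have "p \<in> manifold_boundary B \<A>"
      using U boundary unfolding manifold_boundary_def by blast
    then have max: "?F y \<le> ?F (\<phi> p)" if "y \<in> ?S" for y
      using bd[rule_format, of p] that cf(3) U(2) openin_subset[OF cf(1)] by auto
    have nonpos: "D u \<le> 0" if u: "u \<in> span B" "0 \<le> u \<bullet> b" for u
    proof (rule ccontr)
      assume "\<not> D u \<le> 0"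
      then have Du: "D u > 0"
        by simp
      define e where "e = r / (1 + norm u)"
      have e: "e > 0"
        using boundary(4) unfolding e_def by (simp add: add_pos_nonneg)
      have seg: "\<phi> p + s *\<^sub>R u \<in> ?S" if s: "0 \<le> s" "s < e" for s
      proof -
        have "s * norm u \<le> e * (1 + norm u)"
          using s by (intro mult_mono) auto
        also have "\<dots> = r"
          unfolding e_def by (simp add: add_nonneg_eq_0_iff)
        finally have "\<phi> p + s *\<^sub>R u \<in> cball (\<phi> p) r"
          using s by (simp add: dist_norm)
        moreover have "\<phi> p + s *\<^sub>R u \<in> half_space B b"
          using u s boundary(3) pS cf(5) unfolding half_space_def
          by (auto simp: span_add span_scale inner_add_left)
        ultimately show ?thesis
          using boundary(5) by blast
      qed
      from derivative_along_segment[OF D seg]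
      have "((\<lambda>s. ?F (\<phi> p + s *\<^sub>R u)) has_real_derivative D u) (at 0 within {0..<e})" .
      from has_real_derivative_pos_inc_right[OF this Du]
      obtain d where d: "d > 0" "\<And>h. h > 0 \<Longrightarrow> 0 + h \<in> {0..<e} \<Longrightarrow> h < d \<Longrightarrow>
          ?F (\<phi> p + 0 *\<^sub>R u) < ?F (\<phi> p + (0 + h) *\<^sub>R u)"
        by blast
      define h where "h = min d e / 2"
      have h: "h > 0" "h < d" "h < e"
        using d(1) e unfolding h_def by auto
      have "?F (\<phi> p) < ?F (\<phi> p + h *\<^sub>R u)"
        using d(2)[of h] h by simp
      moreover have "?F (\<phi> p + h *\<^sub>R u) \<le> ?F (\<phi> p)"
        using max seg[of h] h by simp
      ultimately show False
        by simp
    qed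
    define v where "v = (if 0 \<le> w \<bullet> b then w else - w)"
    have v: "v \<in> span B" "0 \<le> v \<bullet> b" "D v \<noteq> 0"
      using w neg unfolding v_def by (auto simp: span_neg)
    then have "D v < 0"
      using nonpos[of v] by linarith
    moreover have "closed (half_space B b)"
    proof -
      have "half_space B b = span B \<inter> {x. 0 \<le> x \<bullet> b}"
        unfolding half_space_def by auto
      moreover have "closed {x. 0 \<le> x \<bullet> b}"
        by (intro closed_Collect_le continuous_intros)
      ultimately show ?thesis
        by (simp add: closed_Int)
    qed
    moreover have "x + s *\<^sub>R v \<in> half_space B b" if "x \<in> half_space B b" "0 \<le> s" for x s
      using that v unfolding half_space_def by (auto simp: span_add span_scale inner_add_left)
    ultimately show ?thesis
      using that[of "half_space B b" r v] boundary(4,5) by blast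
  qed
qed

text \<open>Since \<open>f\<close> is of class \<open>C\<^sup>1\<close>, the derivative along the chosen direction stays negative in
  a whole ball.  Hence \<open>f\<close> decreases along all segments in that direction inside the ball, and the
  ball contains no critical points.\<close>

lemma descent_chart_at_regular_point:
  fixes f :: "'a \<Rightarrow> real" and \<phi> :: "'a \<Rightarrow> 'e::euclidean_space"
  assumes M: "smooth_manifold B \<A> M" and f: "C1_function \<A> f"
    and bd: "\<forall>p\<in>manifold_boundary B \<A>. \<forall>x\<in>topspace M. f x \<le> f p"
    and U: "(U, \<phi>) \<in> \<A>" "p \<in> U" and reg: "p \<notin> critical_points \<A> f"
  obtains H r v where "closed H" "r > 0" "\<phi> ` U \<inter> cball (\<phi> p) r = H \<inter> cball (\<phi> p) r"
    "\<forall>x\<in>H. \<forall>s\<ge>0. x + s *\<^sub>R v \<in> H"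
    "\<forall>x\<in>H \<inter> cball (\<phi> p) r. \<forall>s>0. x + s *\<^sub>R v \<in> cball (\<phi> p) r \<longrightarrow>
        (f \<circ> inv_into U \<phi>) (x + s *\<^sub>R v) < (f \<circ> inv_into U \<phi>) x"
    "\<forall>q\<in>U. \<phi> q \<in> ball (\<phi> p) r \<longrightarrow> q \<notin> critical_points \<A> f"
proof -
  let ?F = "f \<circ> inv_into U \<phi>" and ?S = "\<phi> ` U"
  have ch: "is_chart B M (U, \<phi>)"
    using M U(1) unfolding smooth_manifold_def by auto
  have compat: "\<forall>c\<in>\<A>. compatible_charts c (U, \<phi>)"
    using M U(1) unfolding smooth_manifold_def by blast
  have pS: "\<phi> p \<in> ?S"
    using U(2) by blast
  have "C_k_on 1 ?S ?F"
    using f U(1) unfolding C1_function_def by blast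
  from C1_on_local_extension[OF this pS order_refl]
  obtain G g where G: "open G" "\<phi> p \<in> G" and g: "\<And>y. y \<in> G \<Longrightarrow> g differentiable (at y)"
    and cont: "\<And>v. continuous_on G (\<lambda>y. frechet_derivative g (at y) v)"
    and gF: "\<And>y. y \<in> ?S \<inter> G \<Longrightarrow> g y = ?F y"
    and D: "\<And>y. y \<in> ?S \<inter> G \<Longrightarrow> (?F has_derivative frechet_derivative g (at y)) (at y within ?S)"
    by metis
  have "(?F has_derivative frechet_derivative g (at (\<phi> p))) (at (\<phi> p) within ?S)"
    using D pS G(2) by blast
  from descent_direction_at_regular_point[OF M bd U reg this]
  obtain H r0 v where H: "closed H" "r0 > 0" "?S \<inter> cball (\<phi> p) r0 = H \<inter> cball (\<phi> p) r0"
    and cone: "\<And>x s. x \<in> H \<Longrightarrow> 0 \<le> s \<Longrightarrow> x + s *\<^sub>R v \<in> H"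
    and neg: "frechet_derivative g (at (\<phi> p)) v < 0"
    by metis
  have "open ((\<lambda>y. frechet_derivative g (at y) v) -` {..<0} \<inter> G)"
    using cont[of v] G(1) by (simp add: continuous_on_open_vimage Int_commute)
  then obtain r1 where r1: "r1 > 0"
      "cball (\<phi> p) r1 \<subseteq> (\<lambda>y. frechet_derivative g (at y) v) -` {..<0} \<inter> G"
    using neg G(2) open_contains_cball_eq by (metis (no_types, lifting) IntI lessThan_iff vimageI)
  define r where "r = min r0 r1"
  have r: "r > 0"
    using H(2) r1(1) unfolding r_def by simp
  have r_neg: "frechet_derivative g (at y) v < 0" and r_G: "y \<in> G" if "y \<in> cball (\<phi> p) r" for y
    using r1(2) that unfolding r_def by auto
  have S_H: "?S \<inter> cball (\<phi> p) r = H \<inter> cball (\<phi> p) r"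
  proof -
    have "cball (\<phi> p) r \<subseteq> cball (\<phi> p) r0"
      unfolding r_def by auto
    then show ?thesis
      using H(3) by blast
  qed
  have less: "?F (x + s *\<^sub>R v) < ?F x"
    if x: "x \<in> H \<inter> cball (\<phi> p) r" and s: "0 < s" and y: "x + s *\<^sub>R v \<in> cball (\<phi> p) r" for x s
  proof -
    have seg: "x + t *\<^sub>R v \<in> cball (\<phi> p) r" if t: "0 \<le> t" "t \<le> s" for t
    proof -
      have "(1 - t / s) *\<^sub>R x + (t / s) *\<^sub>R (x + s *\<^sub>R v) \<in> cball (\<phi> p) r"
        using x y s t by (intro convexD_alt convex_cball) auto
      moreover have "(1 - t / s) *\<^sub>R x + (t / s) *\<^sub>R (x + s *\<^sub>R v) = x + t *\<^sub>R v"
        using s by (simp add: algebra_simps)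
      ultimately show ?thesis
        by simp
    qed
    have "g (x + s *\<^sub>R v) < g (x + 0 *\<^sub>R v)"
    proof (rule DERIV_neg_imp_decreasing[OF s])
      fix t assume "0 \<le> t" "t \<le> s"
      then show "\<exists>y. ((\<lambda>t. g (x + t *\<^sub>R v)) has_real_derivative y) (at t) \<and> y < 0"
        using directional_DERIV[OF g[OF r_G[OF seg]]] r_neg[OF seg] by blast
    qed
    moreover have "x + s *\<^sub>R v \<in> H"
      using cone x s by simp
    then have "x + s *\<^sub>R v \<in> ?S \<inter> G" "x \<in> ?S \<inter> G"
      using x y S_H r_G by blast+
    ultimately show ?thesis
      using gF by simp
  qed
  have no_crit: "q \<notin> critical_points \<A> f" if q: "q \<in> U" "\<phi> q \<in> ball (\<phi> p) r" for q
  proof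
    assume "q \<in> critical_points \<A> f"
    from critical_in_chart[OF M ch compat this q(1)]
    have zero: "(?F has_derivative (\<lambda>_. 0)) (at (\<phi> q) within ?S)" .
    have qr: "\<phi> q \<in> cball (\<phi> p) r"
      using q(2) by auto
    have qH: "\<phi> q \<in> H"
      using S_H qr q(1) by blast
    have "open ((\<lambda>s::real. \<phi> q + s *\<^sub>R v) -` ball (\<phi> p) r)"
      by (intro open_vimage open_ball continuous_intros)
    moreover have "0 \<in> (\<lambda>s::real. \<phi> q + s *\<^sub>R v) -` ball (\<phi> p) r"
      using q(2) by simp
    ultimately obtain e where e: "e > 0" "ball 0 e \<subseteq> (\<lambda>s::real. \<phi> q + s *\<^sub>R v) -` ball (\<phi> p) r"
      using open_contains_ball by blast
    have "\<phi> q + s *\<^sub>R v \<in> ?S" if s: "0 \<le> s" "s < e" for s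
    proof -
      have "s \<in> ball 0 e"
        using s by simp
      then have "\<phi> q + s *\<^sub>R v \<in> cball (\<phi> p) r"
        using e(2) ball_subset_cball by blast
      moreover have "\<phi> q + s *\<^sub>R v \<in> H"
        using cone qH s by blast
      ultimately show ?thesis
        using S_H by blast
    qed
    moreover have "(?F has_derivative frechet_derivative g (at (\<phi> q))) (at (\<phi> q) within ?S)"
      using D r_G[OF qr] q(1) by blast
    ultimately have "frechet_derivative g (at (\<phi> q)) v = 0"
      using zero_derivative_along_direction zero e(1) by blast
    then show False
      using r_neg[OF qr] by simp
  qed
  show ?thesis
  proof (rule that[OF H(1) r S_H])
    show "\<forall>x\<in>H. \<forall>s\<ge>0. x + s *\<^sub>R v \<in> H"
      using cone by blast
    show "\<forall>x\<in>H \<inter> cball (\<phi> p) r. \<forall>s>0. x + s *\<^sub>R v \<in> cball (\<phi> p) r \<longrightarrow>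
        ?F (x + s *\<^sub>R v) < ?F x"
      using less by blast
    show "\<forall>q\<in>U. \<phi> q \<in> ball (\<phi> p) r \<longrightarrow> q \<notin> critical_points \<A> f"
      using no_crit by blast
  qed
qed

lemma closedin_critical_points:
  assumes M: "smooth_manifold B \<A> M" and f: "C1_function \<A> f"
    and bd: "\<forall>p\<in>manifold_boundary B \<A>. \<forall>x\<in>topspace M. f x \<le> f p"
  shows "closedin M (critical_points \<A> f)"
  unfolding closedin_def
proof
  show "critical_points \<A> f \<subseteq> topspace M"
    using M unfolding critical_points_def smooth_manifold_def by blast
  show "openin M (topspace M - critical_points \<A> f)"
  proof (subst openin_subopen, intro ballI)
    fix p assume p: "p \<in> topspace M - critical_points \<A> f"
    then obtain U \<phi> where U: "(U, \<phi>) \<in> \<A>" "p \<in> U"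
      using M unfolding smooth_manifold_def by blast
    have ch: "is_chart B M (U, \<phi>)"
      using M U(1) unfolding smooth_manifold_def by blast
    obtain r where r: "r > 0"
        and no_crit: "\<forall>q\<in>U. \<phi> q \<in> ball (\<phi> p) r \<longrightarrow> q \<notin> critical_points \<A> f"
      by (rule descent_chart_at_regular_point[OF M f bd U]) (use p in auto)
    have "openin M {x \<in> U. \<phi> x \<in> ball (\<phi> p) r}"
      by (rule chart_preimage_open[OF chart_facts(1,2)[OF ch] open_ball])
    moreover have "p \<in> {x \<in> U. \<phi> x \<in> ball (\<phi> p) r}"
      using U(2) r by simp
    moreover have "{x \<in> U. \<phi> x \<in> ball (\<phi> p) r} \<subseteq> topspace M - critical_points \<A> f"
      using no_crit openin_subset[OF chart_facts(1)[OF ch]] by blast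
    ultimately show "\<exists>T. openin M T \<and> p \<in> T \<and> T \<subseteq> topspace M - critical_points \<A> f"
      by blast
  qed
qed

text \<open>Every point \<open>y\<close> of the chart image is moved by \<open>\<rho> y\<close> times the descent direction, where \<open>\<rho>\<close> is a
  cut-off function supported in a ball of radius \<open>\<eta>\<close>.  The value of \<open>\<eta>\<close> is small enough that
  points of that ball remain in the ball of radius \<open>r\<close> on which \<open>f\<close> is known to decrease.\<close>

lemma descending_map_at_regular_point:
  fixes f :: "'a \<Rightarrow> real" and \<A> :: "('a, 'e::euclidean_space) chart set"
  assumes M: "smooth_manifold B \<A> M" and f: "C1_function \<A> f"
    and bd: "\<forall>p\<in>manifold_boundary B \<A>. \<forall>x\<in>topspace M. f x \<le> f p"
    and p: "p \<in> topspace M - critical_points \<A> f"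
  shows "\<exists>h. descending_map M (critical_points \<A> f) f h \<and> f (h p) < f p"
proof -
  obtain U \<phi> where U: "(U, \<phi>) \<in> \<A>" "p \<in> U"
    using M p unfolding smooth_manifold_def by blast
  have ch: "is_chart B M (U, \<phi>)"
    using M U(1) unfolding smooth_manifold_def by blast
  note cf = chart_facts[OF ch]
  let ?F = "f \<circ> inv_into U \<phi>" and ?S = "\<phi> ` U"
  have reg: "p \<notin> critical_points \<A> f"
    using p by blast
  obtain H r v where H: "closed H" "r > 0" "?S \<inter> cball (\<phi> p) r = H \<inter> cball (\<phi> p) r"
    and cone: "\<forall>x\<in>H. \<forall>s\<ge>0. x + s *\<^sub>R v \<in> H"
    and less: "\<forall>x\<in>H \<inter> cball (\<phi> p) r. \<forall>s>0. x + s *\<^sub>R v \<in> cball (\<phi> p) r \<longrightarrow>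
        ?F (x + s *\<^sub>R v) < ?F x"
    and no_crit: "\<forall>q\<in>U. \<phi> q \<in> ball (\<phi> p) r \<longrightarrow> q \<notin> critical_points \<A> f"
    by (rule descent_chart_at_regular_point[OF M f bd U reg]) (rule that; assumption)
  define \<eta> where "\<eta> = r / (2 + norm v)"
  have \<eta>_eq: "\<eta> * 2 + \<eta> * norm v = r"
  proof -
    have "2 + norm v \<noteq> 0"
      using norm_ge_zero[of v] by linarith
    then have "\<eta> * (2 + norm v) = r"
      unfolding \<eta>_def by simp
    then show ?thesis
      by (simp add: distrib_left)
  qed
  have "\<eta> > 0"
    unfolding \<eta>_def using H(2) norm_ge_zero[of v] by (intro divide_pos_pos) linarith+
  moreover have "\<eta> * norm v \<ge> 0"
    using calculation by simp
  ultimately have \<eta>: "\<eta> > 0" "\<eta> < r" and \<eta>_r: "\<eta> + \<eta> * norm v \<le> r"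
    using \<eta>_eq by linarith+
  define \<rho> where "\<rho> y = max 0 (\<eta> - dist (\<phi> p) y)" for y
  define q where "q y = y + \<rho> y *\<^sub>R v" for y
  define h where "h x = (if x \<in> U then inv_into U \<phi> (q (\<phi> x)) else x)" for x
  have \<rho>: "0 \<le> \<rho> y" "\<rho> y \<le> \<eta>" "\<rho> y > 0 \<longleftrightarrow> y \<in> ball (\<phi> p) \<eta>" for y
    using \<eta>(1) unfolding \<rho>_def by auto
  have in_H: "y \<in> H \<inter> cball (\<phi> p) r" if "y \<in> ?S" "\<rho> y > 0" for y
  proof -
    have "y \<in> cball (\<phi> p) r"
      using that(2) \<rho>(3)[of y] \<eta>(2) by auto
    then show ?thesis
      using that(1) H(3) by blast
  qed
  have push: "y + s *\<^sub>R v \<in> ?S \<inter> cball (\<phi> p) r" if y: "y \<in> ?S" "\<rho> y > 0" and s: "0 \<le> s" "s \<le> \<rho> y" for y s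
  proof -
    have "norm (\<phi> p - (y + s *\<^sub>R v)) \<le> dist (\<phi> p) y + s * norm v"
      using norm_triangle_ineq4[of "\<phi> p - y" "s *\<^sub>R v"] s(1) by (simp add: dist_norm diff_diff_eq)
    also have "\<dots> \<le> \<eta> + \<eta> * norm v"
      using \<rho>(3)[of y] y(2) s order_trans[OF s(2) \<rho>(2)] by (intro add_mono mult_right_mono) auto
    finally have "y + s *\<^sub>R v \<in> cball (\<phi> p) r"
      using \<eta>_r by (simp add: dist_norm)
    moreover have "y + s *\<^sub>R v \<in> H"
      using cone in_H[OF y] s(1) by blast
    ultimately show ?thesis
      using H(3) by blast
  qed
  have "homotopic_with (\<lambda>_. True) M M id (\<lambda>x. if x \<in> U then inv_into U \<phi> (q (\<phi> x)) else x)"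
  proof (rule chart_push_homotopic_id[where D = "?S \<inter> cball (\<phi> p) \<eta>"])
    show "Hausdorff_space M"
      using M unfolding smooth_manifold_def by blast
    have "?S \<inter> cball (\<phi> p) \<eta> = H \<inter> cball (\<phi> p) \<eta>"
    proof -
      have "cball (\<phi> p) \<eta> \<subseteq> cball (\<phi> p) r"
        using \<eta>(2) by auto
      then show ?thesis
        using H(3) by blast
    qed
    then show "compact (?S \<inter> cball (\<phi> p) \<eta>)"
      using H(1) by (simp add: closed_Int_compact)
    show "continuous_on ?S q"
      unfolding q_def[abs_def] \<rho>_def[abs_def] by (intro continuous_intros)
    fix y assume y: "y \<in> ?S"
    show "q y = y" if "y \<notin> ?S \<inter> cball (\<phi> p) \<eta>"
      using that y unfolding q_def \<rho>_def by auto
    fix t :: real assume t: "0 \<le> t" "t \<le> 1"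
    show "y + t *\<^sub>R (q y - y) \<in> ?S"
    proof (cases "\<rho> y > 0")
      case True
      have "t * \<rho> y \<le> \<rho> y"
        using t \<rho>(1) by (simp add: mult_left_le_one_le)
      then show ?thesis
        using push[OF y True, of "t * \<rho> y"] t \<rho>(1) unfolding q_def by simp
    next
      case False
      then show ?thesis
        using y \<rho>(1)[of y] unfolding q_def by simp
    qed
  qed (use cf in auto)
  then have hom: "homotopic_with (\<lambda>_. True) M M id h"
    unfolding h_def[abs_def] .
  have stay: "h x = x" if "x \<in> U \<Longrightarrow> \<not> \<rho> (\<phi> x) > 0" for x
  proof (cases "x \<in> U")
    case True
    then have "q (\<phi> x) = \<phi> x"
      using that \<rho>(1)[of "\<phi> x"] unfolding q_def by simp
    then show ?thesis
      using True cf(3) unfolding h_def by simp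
  qed (simp add: h_def)
  have fall: "f (h x) < f x" if x: "x \<in> U" "\<rho> (\<phi> x) > 0" for x
  proof -
    have xS: "\<phi> x \<in> ?S"
      using x(1) by blast
    have "q (\<phi> x) \<in> ?S \<inter> cball (\<phi> p) r"
      using push[OF xS x(2), of "\<rho> (\<phi> x)"] \<rho>(1) unfolding q_def by simp
    then have "?F (q (\<phi> x)) < ?F (\<phi> x)"
      using less in_H[OF xS x(2)] x(2) unfolding q_def by blast
    then show ?thesis
      using x(1) cf(3) unfolding h_def by simp
  qed
  have "h x = x" if "x \<in> critical_points \<A> f" for x
  proof (rule stay)
    assume "x \<in> U"
    then have "\<phi> x \<notin> ball (\<phi> p) r"
      using no_crit that by blast
    then show "\<not> \<rho> (\<phi> x) > 0"
      using \<rho>(3)[of "\<phi> x"] \<eta>(2) by auto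
  qed
  then have "descending_map M (critical_points \<A> f) f h"
    using hom stay fall unfolding descending_map_def deformation_map_def by blast
  moreover have "f (h p) < f p"
    using fall U(2) \<rho>(3) \<eta>(1) by simp
  ultimately show ?thesis
    by blast
qed

section \<open>Critical submanifolds\<close>

lemma slice_chart_near:
  fixes \<A> :: "('a, 'e::euclidean_space) chart set"
  assumes M: "smooth_manifold B \<A> M" and N: "submanifold_without_boundary B \<A> M N" and p: "p \<in> N"
  obtains U \<phi> C r where "p \<in> U" "is_chart B M (U, \<phi>)" "\<forall>c\<in>\<A>. compatible_charts c (U, \<phi>)"
    "C \<subseteq> B" "r > 0" "span B \<inter> cball (\<phi> p) r \<subseteq> \<phi> ` U" "\<forall>x\<in>U. x \<in> N \<longleftrightarrow> \<phi> x \<in> span C"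
proof -
  obtain U \<phi> C where U: "p \<in> U" "is_chart B M (U, \<phi>)" "\<forall>c\<in>\<A>. compatible_charts (U, \<phi>) c"
      "openin (top_of_set (span B)) (\<phi> ` U)" "C \<subseteq> B" "\<phi> ` (U \<inter> N) = \<phi> ` U \<inter> span C"
    using N p unfolding submanifold_without_boundary_def by metis
  have inj: "inj_on \<phi> U"
    using chart_facts(3)[OF U(2)] .
  have compat: "\<forall>c\<in>\<A>. compatible_charts c (U, \<phi>)"
    using U(3) unfolding compatible_charts_def by (auto simp: Int_commute)
  have slice: "x \<in> N \<longleftrightarrow> \<phi> x \<in> span C" if x: "x \<in> U" for x
  proof
    assume "x \<in> N"
    then show "\<phi> x \<in> span C"
      using U(6) x by blast
  next
    assume "\<phi> x \<in> span C"
    then have "\<phi> x \<in> \<phi> ` (U \<inter> N)"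
      using U(6) x by blast
    then obtain y where "y \<in> U" "y \<in> N" "\<phi> x = \<phi> y"
      by blast
    then show "x \<in> N"
      using inj x by (metis inj_onD)
  qed
  obtain T where T: "open T" "\<phi> ` U = span B \<inter> T"
    using U(4) unfolding openin_open by metis
  then have "\<phi> p \<in> T"
    using U(1) by blast
  then obtain r where "r > 0" "cball (\<phi> p) r \<subseteq> T"
    using T(1) open_contains_cball by metis
  moreover from this have "span B \<inter> cball (\<phi> p) r \<subseteq> \<phi> ` U"
    using T(2) by auto
  ultimately show ?thesis
    using that U(1,2,5) compat slice by metis
qed

text \<open>In a slice chart the submanifold is a piece of a linear subspace on which the derivative of
  \<open>f\<close> vanishes, so \<open>f\<close> is locally constant on the submanifold, and connectedness makes it constant.\<close>

lemma constant_on_critical_submanifold: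
  fixes \<A> :: "('a, 'e::euclidean_space) chart set"
  assumes M: "smooth_manifold B \<A> M" and N: "submanifold_without_boundary B \<A> M N"
    and conn: "connectedin M N" and crit: "N \<subseteq> critical_points \<A> f"
    and x: "x \<in> N" and y: "y \<in> N"
  shows "f x = f y"
proof -
  have loc: "\<exists>G. openin M G \<and> p \<in> G \<and> (\<forall>q\<in>G \<inter> N. f q = f p)" if p: "p \<in> N" for p
  proof -
    obtain U \<phi> C r where U: "p \<in> U" "is_chart B M (U, \<phi>)"
        and compat: "\<forall>c\<in>\<A>. compatible_charts c (U, \<phi>)"
        and C: "C \<subseteq> B" and r: "r > 0" "span B \<inter> cball (\<phi> p) r \<subseteq> \<phi> ` U"
        and slice: "\<forall>x\<in>U. x \<in> N \<longleftrightarrow> \<phi> x \<in> span C"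
      by (rule slice_chart_near[OF M N p]) (rule that; assumption)
    note cf = chart_facts[OF U(2)]
    let ?F = "f \<circ> inv_into U \<phi>" and ?K = "span C \<inter> cball (\<phi> p) r"
    have K: "?K \<subseteq> \<phi> ` U"
      using r(2) span_mono[OF C] by blast
    have "(?F has_derivative (\<lambda>_. 0)) (at z within ?K)" if z: "z \<in> ?K" for z
    proof -
      obtain q where q: "q \<in> U" "z = \<phi> q"
        using K z by blast
      then have "q \<in> critical_points \<A> f"
        using slice z crit by blast
      then have "(?F has_derivative (\<lambda>_. 0)) (at (\<phi> q) within \<phi> ` U)"
        using critical_in_chart[OF M U(2) compat _ q(1)] by blast
      then show ?thesis
        unfolding q(2) using K by (rule has_derivative_subset)
    qed
    moreover have "convex ?K"
      by (intro convex_Int subspace_imp_convex subspace_span convex_cball)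
    ultimately obtain c where c: "\<And>z. z \<in> ?K \<Longrightarrow> ?F z = c"
      using has_derivative_zero_constant[of ?K ?F] by blast
    let ?G = "{q \<in> U. \<phi> q \<in> ball (\<phi> p) r}"
    have fc: "f q = c" if "q \<in> ?G \<inter> N" for q
    proof -
      have "\<phi> q \<in> ?K"
        using that slice by auto
      then have "?F (\<phi> q) = c"
        by (rule c)
      then show ?thesis
        using that cf(3) by simp
    qed
    have "openin M ?G"
      by (rule chart_preimage_open[OF cf(1,2) open_ball])
    moreover have pG: "p \<in> ?G"
      using U(1) r(1) by simp
    moreover have "\<forall>q\<in>?G \<inter> N. f q = f p"
      using fc fc[of p] pG p by simp
    ultimately show ?thesis
      by blast
  qed
  have top: "topspace (subtopology M N) = N"
    using connectedin_subset_topspace[OF conn] by auto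
  have op: "openin (subtopology M N) {q \<in> N. P (f q)}" for P
  proof (subst openin_subopen, intro ballI)
    fix p assume "p \<in> {q \<in> N. P (f q)}"
    then have p: "p \<in> N" "P (f p)"
      by auto
    obtain G where G: "openin M G" "p \<in> G" "\<forall>q\<in>G \<inter> N. f q = f p"
      using loc[OF p(1)] by blast
    have "openin (subtopology M N) (G \<inter> N)"
      using G(1) by (rule openin_subtopology_Int)
    moreover have "G \<inter> N \<subseteq> {q \<in> N. P (f q)}"
      using G(3) p(2) by auto
    ultimately show "\<exists>T. openin (subtopology M N) T \<and> p \<in> T \<and> T \<subseteq> {q \<in> N. P (f q)}"
      using G(2) p(1) by blast
  qed
  let ?T = "{q \<in> N. f q = f y}"
  have "N - ?T = {q \<in> N. f q \<noteq> f y}"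
    by auto
  then have "closedin (subtopology M N) ?T"
    using op[of "\<lambda>t. t \<noteq> f y"] unfolding closedin_def top by auto
  moreover have "openin (subtopology M N) ?T"
    using op[of "\<lambda>t. t = f y"] .
  ultimately have "?T = {} \<or> ?T = N"
    using conn top unfolding connectedin_def connected_space_clopen_in by auto
  then show ?thesis
    using x y by auto
qed

text \<open>In a slice chart, \<open>N\<close> is the coordinate subspace \<open>span C\<close>.  Points are pushed towards their
  orthogonal projection \<open>\<pi> y\<close> onto it, all the way for points in the ball of radius \<open>r / 2\<close> and
  with a cut-off between \<open>r / 2\<close> and \<open>r\<close>.  As \<open>\<phi> p\<close> is in the subspace, the projection does
  not increase the distance to it, so the ball is preserved.\<close>

lemma deformation_onto_slice:
  fixes \<A> :: "('a, 'e::euclidean_space) chart set"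
  assumes M: "smooth_manifold B \<A> M" and N: "submanifold_without_boundary B \<A> M N" and p: "p \<in> N"
  shows "\<exists>h W. deformation_map M N h \<and> openin M W \<and> p \<in> W \<and> h ` W \<subseteq> N"
proof -
  obtain U \<phi> C r where U: "p \<in> U" "is_chart B M (U, \<phi>)"
      and C: "C \<subseteq> B" and r: "r > 0" "span B \<inter> cball (\<phi> p) r \<subseteq> \<phi> ` U"
      and slice: "\<forall>x\<in>U. x \<in> N \<longleftrightarrow> \<phi> x \<in> span C"
    by (rule slice_chart_near[OF M N p]) (rule that; assumption)
  note cf = chart_facts[OF U(2)]
  let ?S = "\<phi> ` U"
  have B: "B \<subseteq> Basis"
    using M unfolding smooth_manifold_def by blast
  then have CB: "C \<subseteq> Basis"
    using C by blast
  then have finC: "finite C"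
    using finite_Basis by (rule finite_subset)
  have S_B: "?S \<inter> cball (\<phi> p) r = span B \<inter> cball (\<phi> p) r"
    using r(2) cf(5) by blast
  define \<pi> where "\<pi> y = (\<Sum>b\<in>C. (y \<bullet> b) *\<^sub>R b)" for y :: 'e
  have \<pi>_C: "\<pi> y \<in> span C" for y
    unfolding \<pi>_def by (intro span_sum span_scale span_base)
  have \<pi>_inner: "\<pi> y \<bullet> b = (if b \<in> C then y \<bullet> b else 0)" if b: "b \<in> Basis" for y b
  proof -
    have "\<pi> y \<bullet> b = (\<Sum>c\<in>C. if c = b then y \<bullet> b else 0)"
      unfolding \<pi>_def inner_sum_left using CB b
      by (intro sum.cong) (auto simp: inner_Basis)
    then show ?thesis
      using finC by simp
  qed
  have \<pi>_fix: "\<pi> y = y" if "y \<in> span C" for y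
    using that unfolding \<pi>_def
  proof (induction rule: span_induct_alt)
    case base
    then show ?case
      by simp
  next
    case (step a x y)
    have "(\<Sum>b\<in>C. (x \<bullet> b) *\<^sub>R b) = (\<Sum>b\<in>C. if b = x then x else 0)"
      using CB step(1) by (intro sum.cong) (auto simp: inner_Basis subset_iff)
    then have "(\<Sum>b\<in>C. (x \<bullet> b) *\<^sub>R b) = x"
      using finC step(1) by simp
    then show ?case
      using step(2)
      by (simp add: inner_add_left scaleR_add_left sum.distrib flip: scaleR_scaleR scaleR_sum_right)
  qed
  have \<pi>_diff: "\<pi> y - \<pi> z = \<pi> (y - z)" for y z
    unfolding \<pi>_def by (simp add: inner_diff_left scaleR_diff_left sum_subtractf)
  have pC: "\<phi> p \<in> span C"
    using slice U(1) p by blast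
  have \<pi>_near: "dist (\<phi> p) (\<pi> y) \<le> dist (\<phi> p) y" for y
  proof -
    have "norm (\<pi> (y - \<phi> p)) \<le> norm (y - \<phi> p)"
      by (rule norm_le_componentwise) (simp add: \<pi>_inner)
    then show ?thesis
      using \<pi>_fix[OF pC] \<pi>_diff[of y "\<phi> p"] by (simp add: dist_norm norm_minus_commute[of "\<phi> p"])
  qed
  define \<rho> where "\<rho> y = min 1 (max 0 (2 - 2 * dist (\<phi> p) y / r))" for y
  define q where "q y = y + \<rho> y *\<^sub>R (\<pi> y - y)" for y
  define h where "h x = (if x \<in> U then inv_into U \<phi> (q (\<phi> x)) else x)" for x
  have \<rho>: "0 \<le> \<rho> y" "\<rho> y \<le> 1" for y
    unfolding \<rho>_def by auto
  have \<rho>_out: "\<rho> y = 0" if "y \<notin> cball (\<phi> p) r" for y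
    using that r(1) unfolding \<rho>_def by (auto simp: field_simps)
  have \<rho>_in: "\<rho> y = 1" if "y \<in> ball (\<phi> p) (r / 2)" for y
    using that r(1) unfolding \<rho>_def by (auto simp: field_simps)
  have seg: "y + s *\<^sub>R (\<pi> y - y) \<in> ?S" if y: "y \<in> ?S \<inter> cball (\<phi> p) r" and s: "0 \<le> s" "s \<le> 1" for y s
  proof -
    have "\<pi> y \<in> span B \<inter> cball (\<phi> p) r"
      using \<pi>_C span_mono[OF C] \<pi>_near[of y] y by auto
    moreover have "y \<in> span B \<inter> cball (\<phi> p) r"
      using y S_B by blast
    moreover have "convex (span B \<inter> cball (\<phi> p) r)"
      by (intro convex_Int subspace_imp_convex subspace_span convex_cball)
    ultimately have "(1 - s) *\<^sub>R y + s *\<^sub>R \<pi> y \<in> span B \<inter> cball (\<phi> p) r"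
      using s by (intro convexD_alt) auto
    moreover have "(1 - s) *\<^sub>R y + s *\<^sub>R \<pi> y = y + s *\<^sub>R (\<pi> y - y)"
      by (simp add: algebra_simps)
    ultimately show ?thesis
      using r(2) by auto
  qed
  have "homotopic_with (\<lambda>_. True) M M id (\<lambda>x. if x \<in> U then inv_into U \<phi> (q (\<phi> x)) else x)"
  proof (rule chart_push_homotopic_id[where D = "?S \<inter> cball (\<phi> p) r"])
    show "Hausdorff_space M"
      using M unfolding smooth_manifold_def by blast
    show "compact (?S \<inter> cball (\<phi> p) r)"
      unfolding S_B by (simp add: closed_Int_compact)
    show "continuous_on ?S q"
      unfolding q_def[abs_def] \<rho>_def[abs_def] \<pi>_def[abs_def] using r(1) by (intro continuous_intros) auto
    fix y assume y: "y \<in> ?S"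
    show "q y = y" if "y \<notin> ?S \<inter> cball (\<phi> p) r"
      using that y \<rho>_out unfolding q_def by simp
    fix t :: real assume t: "0 \<le> t" "t \<le> 1"
    show "y + t *\<^sub>R (q y - y) \<in> ?S"
    proof (cases "y \<in> cball (\<phi> p) r")
      case True
      have "t * \<rho> y \<le> 1"
        using t \<rho>[of y] by (intro mult_le_one) auto
      then show ?thesis
        using seg[of y "t * \<rho> y"] True y t \<rho>(1)[of y] unfolding q_def by simp
    next
      case False
      then show ?thesis
        using y \<rho>_out unfolding q_def by simp
    qed
  qed (use cf in auto)
  then have "homotopic_with (\<lambda>_. True) M M id h"
    unfolding h_def[abs_def] .
  moreover have "h x = x" if "x \<in> N" for x
  proof (cases "x \<in> U")
    case True
    then have "q (\<phi> x) = \<phi> x"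
      using that slice \<pi>_fix unfolding q_def by simp
    then show ?thesis
      using True cf(3) unfolding h_def by simp
  qed (simp add: h_def)
  ultimately have "deformation_map M N h"
    unfolding deformation_map_def by blast
  moreover have "openin M {x \<in> U. \<phi> x \<in> ball (\<phi> p) (r / 2)}"
    by (rule chart_preimage_open[OF cf(1,2) open_ball])
  moreover have "h x \<in> N" if x: "x \<in> U" "\<phi> x \<in> ball (\<phi> p) (r / 2)" for x
  proof -
    have q: "q (\<phi> x) = \<pi> (\<phi> x)"
      using \<rho>_in[OF x(2)] unfolding q_def by simp
    have "\<phi> x \<in> ?S \<inter> cball (\<phi> p) r"
      using x r(1) by auto
    then have "\<pi> (\<phi> x) \<in> ?S"
      using seg[of "\<phi> x" 1] by simp
    then obtain z where z: "z \<in> U" "\<pi> (\<phi> x) = \<phi> z"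
      by blast
    then have "z \<in> N"
      using slice \<pi>_C by metis
    moreover have "h x = z"
      using x(1) q z cf(3) unfolding h_def by simp
    ultimately show ?thesis
      by simp
  qed
  ultimately show ?thesis
    using U(1) r(1) by (intro exI[of _ h] exI[of _ "{x \<in> U. \<phi> x \<in> ball (\<phi> p) (r / 2)}"]) auto
qed

text \<open>Let \<open>k\<close> be followed by \<open>h\<close>.  If \<open>k\<close> carries a neighbourhood of \<open>p\<close> into \<open>N\<close>, so does the
  composite, because \<open>h\<close> fixes \<open>N\<close>.  If \<open>h\<close> does, so does the composite, because \<open>k\<close> is continuous
  and fixes \<open>p\<close>.  Thus a composite is locally at least as good as each of its factors.\<close>

lemma deformations_combine_near_fixed_set:
  assumes "finite F" and "\<And>h. h \<in> F \<Longrightarrow> deformation_map X N h" and N: "N \<subseteq> topspace X"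
  shows "\<exists>h. deformation_map X N h \<and>
           (\<forall>p\<in>N. (\<exists>h'\<in>F. \<exists>W. openin X W \<and> p \<in> W \<and> h' ` W \<subseteq> N) \<longrightarrow>
                  (\<exists>W. openin X W \<and> p \<in> W \<and> h ` W \<subseteq> N))"
  using assms(1,2)
proof (induction F)
  case empty
  show ?case
    using deformation_map_id by blast
next
  case (insert k F)
  then obtain h where h: "deformation_map X N h"
      and hW: "\<And>p. p \<in> N \<Longrightarrow> \<exists>h'\<in>F. \<exists>W. openin X W \<and> p \<in> W \<and> h' ` W \<subseteq> N \<Longrightarrow>
            \<exists>W. openin X W \<and> p \<in> W \<and> h ` W \<subseteq> N"
    by (metis insert_iff)
  have k: "deformation_map X N k"
    using insert.prems by simp
  have "\<exists>W. openin X W \<and> p \<in> W \<and> (h \<circ> k) ` W \<subseteq> N"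
    if p: "p \<in> N" and ex: "\<exists>h'\<in>insert k F. \<exists>W. openin X W \<and> p \<in> W \<and> h' ` W \<subseteq> N" for p
  proof -
    have h_fix: "\<And>x. x \<in> N \<Longrightarrow> h x = x" and k_fix: "k p = p"
      using h k p unfolding deformation_map_def by auto
    consider W where "openin X W" "p \<in> W" "k ` W \<subseteq> N"
      | "\<exists>h'\<in>F. \<exists>W. openin X W \<and> p \<in> W \<and> h' ` W \<subseteq> N"
      using ex by blast
    then show ?thesis
    proof cases
      case 1
      then have "(h \<circ> k) ` W \<subseteq> N"
        using h_fix by auto
      then show ?thesis
        using 1 by blast
    next
      case 2
      then obtain W where W: "openin X W" "p \<in> W" "h ` W \<subseteq> N"
        using hW[OF p] by blast
      let ?V = "{x \<in> topspace X. k x \<in> W}"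
      have "openin X ?V"
        using openin_continuous_map_preimage[OF deformation_map_continuous[OF k] W(1)] .
      moreover have "p \<in> ?V"
        using k_fix W(2) p N by auto
      moreover have "(h \<circ> k) ` ?V \<subseteq> N"
        using W(3) by auto
      ultimately show ?thesis
        by blast
    qed
  qed
  then show ?case
    using deformation_map_compose[OF h k] by blast
qed

lemma neighbourhood_deforms_onto_submanifold:
  fixes \<A> :: "('a, 'e::euclidean_space) chart set"
  assumes M: "smooth_manifold B \<A> M" and N: "submanifold_without_boundary B \<A> M N"
    and comp: "compactin M N"
  shows "\<exists>g W. deformation_map M N g \<and> openin M W \<and> N \<subseteq> W \<and> g ` W \<subseteq> N"
proof -
  obtain h V where hV: "\<And>p. p \<in> N \<Longrightarrow>
      deformation_map M N (h p) \<and> openin M (V p) \<and> p \<in> V p \<and> h p ` V p \<subseteq> N"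
    using deformation_onto_slice[OF M N] by metis
  have "openin M G" if "G \<in> V ` N" for G
    using that hV by auto
  moreover have "N \<subseteq> \<Union>(V ` N)"
    using hV by auto
  ultimately obtain T where T: "finite T" "T \<subseteq> V ` N" "N \<subseteq> \<Union>T"
    using compactinD[OF comp, of "V ` N"] by auto
  then obtain F where F: "finite F" "F \<subseteq> N" "T = V ` F"
    by (meson finite_subset_image)
  have "finite (h ` F)" "\<And>k. k \<in> h ` F \<Longrightarrow> deformation_map M N k"
    using F hV by auto
  then obtain g where g: "deformation_map M N g"
      and gW: "\<forall>p\<in>N. (\<exists>h'\<in>h ` F. \<exists>W. openin M W \<and> p \<in> W \<and> h' ` W \<subseteq> N) \<longrightarrow>
                  (\<exists>W. openin M W \<and> p \<in> W \<and> g ` W \<subseteq> N)"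
    using deformations_combine_near_fixed_set[of "h ` F" M N] compactin_subset_topspace[OF comp] by metis
  have "\<exists>W. openin M W \<and> p \<in> W \<and> g ` W \<subseteq> N" if p: "p \<in> N" for p
  proof -
    obtain s where s: "s \<in> F" "p \<in> V s"
      using p T(3) F(3) by auto
    then have "s \<in> N"
      using F(2) by blast
    then have "openin M (V s) \<and> p \<in> V s \<and> h s ` V s \<subseteq> N"
      using hV s(2) by blast
    then have "\<exists>h'\<in>h ` F. \<exists>W. openin M W \<and> p \<in> W \<and> h' ` W \<subseteq> N"
      using s(1) by blast
    then show ?thesis
      using gW p by simp
  qed
  then obtain W where W: "\<And>p. p \<in> N \<Longrightarrow> openin M (W p) \<and> p \<in> W p \<and> g ` W p \<subseteq> N"
    by metis
  have "openin M (\<Union>p\<in>N. W p)"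
    using W by (intro openin_Union) auto
  moreover have "N \<subseteq> (\<Union>p\<in>N. W p)" "g ` (\<Union>p\<in>N. W p) \<subseteq> N"
    using W by auto
  ultimately show ?thesis
    using g by blast
qed

section \<open>Counting critical submanifolds\<close>

text \<open>The homotopy to \<open>g N\<close> contracts the preimage of \<open>N\<close> to exactly \<open>N\<close>: the image is contained in
  \<open>N\<close> by construction and contains \<open>N\<close> because \<open>g N\<close> fixes it.\<close>

lemma P_cat_le_card:
  assumes fin: "finite \<N>" and closed: "\<And>N. N \<in> \<N> \<Longrightarrow> closedin X N"
    and P: "\<And>N. N \<in> \<N> \<Longrightarrow> subtopology X N homeomorphic_space P"
    and g: "\<And>N. N \<in> \<N> \<Longrightarrow> deformation_map X N (g N)"
    and cover: "\<And>x. x \<in> topspace X \<Longrightarrow> \<exists>N\<in>\<N>. g N x \<in> N"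
  shows "P_cat P X \<le> enat (card \<N>)"
proof -
  define A where "A N = {x \<in> topspace X. g N x \<in> N}" for N
  have A: "closedin X (A N) \<and> contractible_within_to P X (A N)" if N: "N \<in> \<N>" for N
  proof
    show "closedin X (A N)"
      unfolding A_def
      using closedin_continuous_map_preimage[OF deformation_map_continuous[OF g[OF N]] closed[OF N]] .
    have fixed: "\<And>x. x \<in> N \<Longrightarrow> g N x = x" and hom: "homotopic_with (\<lambda>_. True) X X id (g N)"
      using g[OF N] unfolding deformation_map_def by auto
    have "N \<subseteq> topspace X"
      using closed[OF N] closedin_subset by blast
    then have "N \<subseteq> g N ` A N"
      using fixed unfolding A_def by force
    then have "g N ` A N = N"
      unfolding A_def by auto
    then show "contractible_within_to P X (A N)"
      using homotopic_from_subtopology[OF hom] P[OF N] unfolding contractible_within_to_def by metis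
  qed
  obtain e where e: "bij_betw e {..<card \<N>} \<N>"
    using ex_bij_betw_nat_finite[OF fin] by (auto simp: lessThan_atLeast0)
  have "topspace X = (\<Union>N\<in>\<N>. A N)"
    using cover unfolding A_def by auto
  also have "\<dots> = (\<Union>i<card \<N>. A (e i))"
    using e unfolding bij_betw_def by (metis image_image)
  finally have "topspace X = (\<Union>i<card \<N>. A (e i))" .
  moreover have "\<forall>i<card \<N>. closedin X (A (e i)) \<and> contractible_within_to P X (A (e i))"
    using A bij_betwE[OF e] by blast
  ultimately have "card \<N> \<in> {k. \<exists>A :: nat \<Rightarrow> 'a set.
     (\<forall>i<k. closedin X (A i) \<and> contractible_within_to P X (A i)) \<and> topspace X = (\<Union>i<k. A i)}"
    by (intro CollectI exI[of _ "\<lambda>i. A (e i)"]) simp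
  then show ?thesis
    unfolding P_cat_def by (intro Inf_lower imageI)
qed

theorem theorem2p12:
  fixes P :: "'p topology"
    and B\<^sub>P :: "'q::euclidean_space set" and \<A>\<^sub>P :: "('p, 'q) chart set"
    and M :: "'a topology"
    and B :: "'e::euclidean_space set" and \<A> :: "('a, 'e) chart set"
    and f :: "'a \<Rightarrow> real"
  assumes "smooth_manifold B\<^sub>P \<A>\<^sub>P P" and "manifold_boundary B\<^sub>P \<A>\<^sub>P = {}"
    and "smooth_manifold B \<A> M" and "compact_space M" and "connected_space M"
    and "P_function P B \<A> M f"
    and "\<exists>c. \<forall>p\<in>manifold_boundary B \<A>. f p = c \<and> (\<forall>x\<in>topspace M. f x \<le> c)"
    and "manifold_boundary B \<A> \<inter> critical_points \<A> f = {}"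
  shows "P_cat P M \<le> ecard (critical_submanifolds \<A> M f)"
proof (cases "finite (critical_submanifolds \<A> M f)")
  case False
  then show ?thesis
    unfolding ecard_def by simp
next
  case fin: True
  note M = assms(3) and compact = assms(4)
  let ?C = "critical_points \<A> f" and ?\<N> = "critical_submanifolds \<A> M f"
  have f: "C1_function \<A> f"
    and sub: "\<And>N. N \<in> ?\<N> \<Longrightarrow> submanifold_without_boundary B \<A> M N"
    and P: "\<And>N. N \<in> ?\<N> \<Longrightarrow> subtopology M N homeomorphic_space P"
    using assms(6) unfolding P_function_def by auto
  have bd: "\<forall>p\<in>manifold_boundary B \<A>. \<forall>x\<in>topspace M. f x \<le> f p"
    using assms(7) by auto
  have closed_C: "closedin M ?C"
    using closedin_critical_points[OF M f bd] .
  have "topspace (subtopology M ?C) = ?C"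
    using closedin_subset[OF closed_C] by auto
  then have Union: "\<Union>?\<N> = ?C"
    unfolding critical_submanifolds_def using Union_connected_components_of by metis
  have closed: "closedin M N" and conn: "connectedin M N" if N: "N \<in> ?\<N>" for N
  proof -
    have "closedin (subtopology M ?C) N"
      using N closedin_connected_components_of unfolding critical_submanifolds_def by blast
    then show "closedin M N"
      using closed_C closedin_trans_full by blast
    have "connectedin (subtopology M ?C) N"
      using N connectedin_connected_components_of unfolding critical_submanifolds_def by blast
    then show "connectedin M N"
      by (simp add: connectedin_subtopology)
  qed
  have "\<exists>g. (\<forall>N\<in>?\<N>. deformation_map M N (g N)) \<and> (\<forall>x\<in>topspace M. \<exists>N\<in>?\<N>. g N x \<in> N)"
  proof (rule critical_sets_cover[OF compact C1_function_continuous[OF M f] fin,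
        where v = "\<lambda>N. f (SOME x. x \<in> N)"])
    fix p assume "p \<in> topspace M - \<Union>?\<N>"
    then show "\<exists>h. descending_map M (\<Union>?\<N>) f h \<and> f (h p) < f p"
      unfolding Union by (rule descending_map_at_regular_point[OF M f bd])
  next
    fix N assume N: "N \<in> ?\<N>"
    show "\<exists>g W. deformation_map M N g \<and> openin M W \<and> N \<subseteq> W \<and> g ` W \<subseteq> N"
      using neighbourhood_deforms_onto_submanifold[OF M sub[OF N]]
        closedin_compact_space[OF compact closed[OF N]] by blast
    fix x assume "x \<in> N"
    moreover from this have "(SOME x. x \<in> N) \<in> N"
      by (rule someI)
    moreover have "N \<subseteq> ?C"
      using N Union by blast
    ultimately show "f x = f (SOME x. x \<in> N)"
      using constant_on_critical_submanifold[OF M sub[OF N] conn[OF N]] by blast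
  qed
  then obtain g where g: "\<forall>N\<in>?\<N>. deformation_map M N (g N)"
      and cover: "\<forall>x\<in>topspace M. \<exists>N\<in>?\<N>. g N x \<in> N"
    by (elim exE conjE)
  have "P_cat P M \<le> enat (card ?\<N>)"
    by (rule P_cat_le_card[OF fin, where g = g]) (use closed P g cover in blast)+
  then show ?thesis
    using fin unfolding ecard_def by simp
qed

end
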